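(* Let $S$ be a string of length $n$ over an alphabet $\Sigma$. The number of all $3$-sub-cadences of $S$ can be computed in $$\mathcal{O}\left(\min\left(|\Sigma|\,n\log n,\; n^{3/2}(\log n)^{1/2}\right)\right)$$ time.
   Context: A string $S=S[1]S[2]\cdots S[n]$ is a sequence of characters from $\Sigma$. A $3$-sub-cadence of $S$ is a triple $(i,d,3)$ with positive integers $i,d$ such that $i+2d\le n$ and $S[i]=S[i+d]=S[i+2d]$. Computational model: arithmetic operations on integers with $\mathcal{O}(\log n)$ bits take constant time; each character $S[j]$ can be read in constant time; characters are sufficiently small integers, so that they can be sorted. The standard fact that the acyclic convolution of two sequences of length $m$ can be computed in $\mathcal{O}(m\log m)$ operations is assumed. Constants in $\mathcal{O}$ are absolute. *)

theory Defs
  imports Complex_Main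
begin

section \<open>Sub-cadences and convolutions\<close>

text \<open>String positions are counted from 1, so \<open>S[j]\<close> is \<open>S ! (j - 1)\<close>.\<close>

definition three_sub_cadence :: "'a list \<Rightarrow> nat \<Rightarrow> nat \<Rightarrow> bool" where
  "three_sub_cadence S i d \<longleftrightarrow>
     0 < i \<and> 0 < d \<and> i + 2 * d \<le> length S \<and>
     S ! (i - 1) = S ! (i + d - 1) \<and> S ! (i + d - 1) = S ! (i + 2 * d - 1)"

definition three_sub_cadences :: "'a list \<Rightarrow> (nat \<times> nat \<times> nat) set" where
  "three_sub_cadences S = {(i, d, 3) | i d. three_sub_cadence S i d}"

definition acyclic_convolution :: "int list \<Rightarrow> int list \<Rightarrow> int list" where
  "acyclic_convolution a b =
     map (\<lambda>i. \<Sum>(j, k) \<in> {(j, k). j < length a \<and> k < length b \<and> j + k = i}. a ! j * b ! k)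
         [0..<length a + length b - 1]"


section \<open>A random access machine\<close>

text \<open>
  Programs are while-programs over finitely many integer variables and finitely many arrays
  with constant-time access.  The time is the number of elementary operations, each node of an
  expression being one operation.  The parameter \<open>W\<close> is the largest absolute value that fits
  into a machine word: whenever an operand, address or (intermediate) result is larger, or an
  address is negative, or a divisor is zero, the execution is stuck, that is, no derivation of
  \<open>exec\<close> exists.
\<close>

type_synonym vname = string

record state =
  var :: "vname \<Rightarrow> int"
  arr :: "vname \<Rightarrow> nat \<Rightarrow> int"

datatype aop = Add | Sub | Mul | Div | Mod

datatype aexp = Const int | Var vname | Read vname aexp | Bin aop aexp aexp

datatype bexp = Less aexp aexp | Eq aexp aexp | Not bexp | And bexp bexp

datatype com =
    Skip
  | Assign vname aexp
  | Store vname aexp aexp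
  | Seq com com
  | If bexp com com
  | While bexp com

fun apply_op :: "aop \<Rightarrow> int \<Rightarrow> int \<Rightarrow> int" where
  "apply_op Add x y = x + y"
| "apply_op Sub x y = x - y"
| "apply_op Mul x y = x * y"
| "apply_op Div x y = x div y"
| "apply_op Mod x y = x mod y"

fun aval :: "aexp \<Rightarrow> state \<Rightarrow> int" where
  "aval (Const c) s = c"
| "aval (Var x) s = var s x"
| "aval (Read a e) s = arr s a (nat (aval e s))"
| "aval (Bin f e1 e2) s = apply_op f (aval e1 s) (aval e2 s)"

fun bval :: "bexp \<Rightarrow> state \<Rightarrow> bool" where
  "bval (Less e1 e2) s \<longleftrightarrow> aval e1 s < aval e2 s"
| "bval (Eq e1 e2) s \<longleftrightarrow> aval e1 s = aval e2 s"
| "bval (Not b) s \<longleftrightarrow> \<not> bval b s"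
| "bval (And b1 b2) s \<longleftrightarrow> bval b1 s \<and> bval b2 s"

fun asafe :: "int \<Rightarrow> aexp \<Rightarrow> state \<Rightarrow> bool" where
  "asafe W (Const c) s \<longleftrightarrow> \<bar>c\<bar> \<le> W"
| "asafe W (Var x) s \<longleftrightarrow> \<bar>var s x\<bar> \<le> W"
| "asafe W (Read a e) s \<longleftrightarrow>
     asafe W e s \<and> 0 \<le> aval e s \<and> \<bar>aval (Read a e) s\<bar> \<le> W"
| "asafe W (Bin f e1 e2) s \<longleftrightarrow>
     asafe W e1 s \<and> asafe W e2 s \<and> (f \<in> {Div, Mod} \<longrightarrow> aval e2 s \<noteq> 0) \<and>
     \<bar>aval (Bin f e1 e2) s\<bar> \<le> W"

fun bsafe :: "int \<Rightarrow> bexp \<Rightarrow> state \<Rightarrow> bool" where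
  "bsafe W (Less e1 e2) s \<longleftrightarrow> asafe W e1 s \<and> asafe W e2 s"
| "bsafe W (Eq e1 e2) s \<longleftrightarrow> asafe W e1 s \<and> asafe W e2 s"
| "bsafe W (Not b) s \<longleftrightarrow> bsafe W b s"
| "bsafe W (And b1 b2) s \<longleftrightarrow> bsafe W b1 s \<and> bsafe W b2 s"

fun acost :: "aexp \<Rightarrow> nat" where
  "acost (Const c) = 1"
| "acost (Var x) = 1"
| "acost (Read a e) = 1 + acost e"
| "acost (Bin f e1 e2) = 1 + acost e1 + acost e2"

fun bcost :: "bexp \<Rightarrow> nat" where
  "bcost (Less e1 e2) = 1 + acost e1 + acost e2"
| "bcost (Eq e1 e2) = 1 + acost e1 + acost e2"
| "bcost (Not b) = 1 + bcost b"
| "bcost (And b1 b2) = 1 + bcost b1 + bcost b2"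

text \<open>\<open>exec W p s t s'\<close>: with word bound \<open>W\<close>, program \<open>p\<close> started in \<open>s\<close> halts in \<open>s'\<close> after
  exactly \<open>t\<close> operations.\<close>

inductive exec :: "int \<Rightarrow> com \<Rightarrow> state \<Rightarrow> nat \<Rightarrow> state \<Rightarrow> bool" for W where
  Skip: "exec W Skip s 1 s"
| Assign: "asafe W e s \<Longrightarrow>
    exec W (Assign x e) s (1 + acost e) (s\<lparr>var := (var s)(x := aval e s)\<rparr>)"
| Store: "asafe W i s \<Longrightarrow> 0 \<le> aval i s \<Longrightarrow> asafe W e s \<Longrightarrow>
    exec W (Store a i e) s (1 + acost i + acost e)
      (s\<lparr>arr := (arr s)(a := (arr s a)(nat (aval i s) := aval e s))\<rparr>)"
| Seq: "exec W p s t s' \<Longrightarrow> exec W q s' u s'' \<Longrightarrow> exec W (Seq p q) s (t + u) s''"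
| IfTrue: "bsafe W b s \<Longrightarrow> bval b s \<Longrightarrow> exec W p s t s' \<Longrightarrow>
    exec W (If b p q) s (1 + bcost b + t) s'"
| IfFalse: "bsafe W b s \<Longrightarrow> \<not> bval b s \<Longrightarrow> exec W q s t s' \<Longrightarrow>
    exec W (If b p q) s (1 + bcost b + t) s'"
| WhileFalse: "bsafe W b s \<Longrightarrow> \<not> bval b s \<Longrightarrow> exec W (While b p) s (1 + bcost b) s"
| WhileTrue: "bsafe W b s \<Longrightarrow> bval b s \<Longrightarrow> exec W p s t s' \<Longrightarrow>
    exec W (While b p) s' u s'' \<Longrightarrow> exec W (While b p) s (1 + bcost b + t + u) s''"

text \<open>Words of \<open>O(log n)\<close> bits are modelled as integers of absolute value at most \<open>(n + 2)\<^sup>k\<close> for a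
  fixed \<open>k\<close>; the summand 2 only matters for tiny \<open>n\<close>.\<close>

definition word_bound :: "nat \<Rightarrow> nat \<Rightarrow> int" where
  "word_bound k n = (int n + 2) ^ k"

definition array_holds :: "state \<Rightarrow> vname \<Rightarrow> int list \<Rightarrow> bool" where
  "array_holds s a xs \<longleftrightarrow> (\<forall>i < length xs. arr s a i = xs ! i)"


section \<open>Computing convolutions and counting sub-cadences\<close>

text \<open>In both definitions the initial content of the memory outside the input is arbitrary.\<close>

definition convolves_within :: "com \<Rightarrow> nat \<Rightarrow> real \<Rightarrow> int list \<Rightarrow> int list \<Rightarrow> bool" where
  "convolves_within p k T a b \<longleftrightarrow>
     (\<forall>s. var s ''m'' = int (length a) \<and> array_holds s ''a'' a \<and> array_holds s ''b'' b \<longrightarrow>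
       (\<exists>t s'. exec (word_bound k (length a)) p s t s' \<and> real t \<le> T \<and>
               array_holds s' ''c'' (acyclic_convolution a b)))"

definition counts_three_sub_cadences_within :: "com \<Rightarrow> nat \<Rightarrow> real \<Rightarrow> int list \<Rightarrow> bool" where
  "counts_three_sub_cadences_within p k T S \<longleftrightarrow>
     (\<forall>s. var s ''n'' = int (length S) \<and> array_holds s ''S'' S \<longrightarrow>
       (\<exists>t s'. exec (word_bound k (length S)) p s t s' \<and> real t \<le> T \<and>
               var s' ''count'' = int (card (three_sub_cadences S))))"

text \<open>The standard fact on convolutions: two sequences of \<open>m\<close> integers with \<open>O(log m)\<close> bits can be
  convolved in time \<open>O(m log m)\<close>.\<close>

definition fast_convolution :: bool where
  "fast_convolution \<longleftrightarrow>
     (\<forall>c. \<exists>p C k. \<forall>m \<ge> 2. \<forall>a b.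
        length a = m \<and> length b = m \<and> (\<forall>x \<in> set a \<union> set b. \<bar>x\<bar> \<le> word_bound c m) \<longrightarrow>
        convolves_within p k (C * (real m * log 2 (real m))) a b)"

end

theory Submission
  imports Defs "HOL-Library.Countable"
begin

text \<open>
  Sort the keys \<open>S[x] * n + x\<close> by bottom-up merge sort, which takes \<open>r = O(log n)\<close> rounds; afterwards
  the positions of each letter are consecutive.  The sub-cadences of a letter with \<open>f\<close> occurrences
  are counted in time \<open>O(min (f\<^sup>2, n log n))\<close>: if \<open>f\<^sup>2 \<le> n * r\<close>, test all pairs of occurrences as
  first and third position; otherwise convolve the indicator sequence of the letter with itself,
  whose entry at \<open>2 * x\<close> is one more than twice the number of sub-cadences centred at an occurrence
  \<open>x\<close>.  Since \<open>min (f\<^sup>2, n log n)\<close> is at most \<open>n log n\<close> and at most \<open>f * sqrt (n log n)\<close>, and the \<open>f\<close>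
  sum to \<open>n\<close>, this gives both bounds with a single program.
\<close>

section \<open>A weakest precondition calculus that counts time\<close>

text \<open>The order of quantifiers shapes the construction: one program and one constant have to
  serve every exponent \<open>c\<close> that bounds the letters, and only the word exponent
  \<open>k\<close> may depend on \<open>c\<close>. So the time must not depend on the size of the
  letters: they are grouped by comparisons, and the convolution only ever receives 0/1 sequences,
  for which a single convolution program suffices. The program does not compute a logarithm either.
  The number of rounds counted during the sort replaces it, since it lies between
  \<open>log 2 n\<close> and twice that value. A run that leaves the word bound has no derivation in
  \<open>exec\<close>, so every timing statement also carries an overflow argument. Guards evaluate
  all their conjuncts, so even a read whose value is irrelevant must be in range. The memory outside
  the input is arbitrary, so whatever is read must first be written; in particular the convolution
  arrays are refilled for each letter, and the linear cost of this is absorbed by the cost of the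
  convolution.\<close>

definition wp :: "int \<Rightarrow> com \<Rightarrow> (state \<Rightarrow> nat \<Rightarrow> bool) \<Rightarrow> state \<Rightarrow> nat \<Rightarrow> bool" where
  "wp W p Q s t \<longleftrightarrow> (\<exists>u s'. exec W p s u s' \<and> Q s' (t + u))"

fun written_vars :: "com \<Rightarrow> vname set" where
  "written_vars (Assign x e) = {x}"
| "written_vars (Seq p q) = written_vars p \<union> written_vars q"
| "written_vars (If b p q) = written_vars p \<union> written_vars q"
| "written_vars (While b p) = written_vars p"
| "written_vars _ = {}"

fun written_arrs :: "com \<Rightarrow> vname set" where
  "written_arrs (Store a i e) = {a}"
| "written_arrs (Seq p q) = written_arrs p \<union> written_arrs q"
| "written_arrs (If b p q) = written_arrs p \<union> written_arrs q"
| "written_arrs (While b p) = written_arrs p"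
| "written_arrs _ = {}"

lemma finite_written: "finite (written_vars p)" "finite (written_arrs p)"
  by (induction p) auto

text \<open>The write sets are syntactic over-approximations. With them a loop invariant only has to
  mention what the loop changes; the rest of the memory is recovered from
  \<open>frame\<close>.\<close>

definition frame :: "com \<Rightarrow> state \<Rightarrow> state \<Rightarrow> bool" where
  "frame p s s' \<longleftrightarrow> (\<forall>x. x \<notin> written_vars p \<longrightarrow> var s' x = var s x) \<and>
     (\<forall>a. a \<notin> written_arrs p \<longrightarrow> arr s' a = arr s a)"

lemma frame_var: "frame p s s' \<Longrightarrow> x \<notin> written_vars p \<Longrightarrow> var s' x = var s x"
  by (auto simp: frame_def)

lemma frame_arr: "frame p s s' \<Longrightarrow> a \<notin> written_arrs p \<Longrightarrow> arr s' a = arr s a"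
  by (auto simp: frame_def)

lemma frame_refl [simp]: "frame p s s"
  by (auto simp: frame_def)

lemma frame_trans: "frame p s s' \<Longrightarrow> frame p s' s'' \<Longrightarrow> frame p s s''"
  by (auto simp: frame_def)

lemma exec_frame: "exec W p s t s' \<Longrightarrow> frame p s s'"
  by (induction rule: exec.induct) (auto simp: frame_def)

lemma asafe_mono: "asafe W e s \<Longrightarrow> W \<le> W' \<Longrightarrow> asafe W' e s"
  by (induction e) auto

lemma bsafe_mono: "bsafe W b s \<Longrightarrow> W \<le> W' \<Longrightarrow> bsafe W' b s"
  by (induction b) (auto intro: asafe_mono)

lemma exec_mono: "exec W p s t s' \<Longrightarrow> W \<le> W' \<Longrightarrow> exec W' p s t s'"
  by (induction rule: exec.induct) (blast intro: exec.intros asafe_mono bsafe_mono)+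

text \<open>Besides weakening, this rule hands over the frame of \<open>p\<close>. As
  \<open>wp\<close> passes the accumulated time \<open>t + u\<close> on to the postcondition, exact
  times can be weakened here to upper bounds.\<close>

lemma wp_mono:
  assumes "wp W p Q s t" "\<And>s' t'. frame p s s' \<Longrightarrow> Q s' t' \<Longrightarrow> Q' s' t'"
  shows "wp W p Q' s t"
  using assms exec_frame unfolding wp_def by blast

lemma wp_Skip: "Q s (t + 1) \<Longrightarrow> wp W Skip Q s t"
  unfolding wp_def using exec.Skip by blast

lemma wp_Assign:
  "asafe W e s \<Longrightarrow> Q (s\<lparr>var := (var s)(x := aval e s)\<rparr>) (t + (1 + acost e)) \<Longrightarrow>
    wp W (Assign x e) Q s t"
  unfolding wp_def using exec.Assign by blast

lemma wp_Store:
  "asafe W i s \<Longrightarrow> 0 \<le> aval i s \<Longrightarrow> asafe W e s \<Longrightarrow>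
    Q (s\<lparr>arr := (arr s)(a := (arr s a)(nat (aval i s) := aval e s))\<rparr>) (t + (1 + acost i + acost e)) \<Longrightarrow>
    wp W (Store a i e) Q s t"
  unfolding wp_def using exec.Store by blast

lemma wp_Seq: "wp W p (wp W q Q) s t \<Longrightarrow> wp W (Seq p q) Q s t"
  unfolding wp_def by (metis exec.Seq add.assoc)

lemma wp_If:
  assumes "bsafe W b s"
    and "bval b s \<Longrightarrow> wp W p Q s (t + (1 + bcost b))"
    and "\<not> bval b s \<Longrightarrow> wp W q Q s (t + (1 + bcost b))"
  shows "wp W (If b p q) Q s t"
  using assms unfolding wp_def by (metis exec.IfTrue exec.IfFalse add.assoc)

lemmas wp_intros = wp_Skip wp_Assign wp_Store wp_Seq wp_If

text \<open>Induction on the measure gives termination; the time bound is left to the invariant,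
  which sees the accumulated time. All obligations are restricted to states that agree with
  \<open>s0\<close> outside the write sets of the body.\<close>

lemma wp_While:
  fixes \<mu> :: "state \<Rightarrow> nat"
  assumes init: "I s0 t0"
    and safe: "\<And>s t. frame p s0 s \<Longrightarrow> I s t \<Longrightarrow> bsafe W b s"
    and body: "\<And>s t. frame p s0 s \<Longrightarrow> I s t \<Longrightarrow> bval b s \<Longrightarrow>
      wp W p (\<lambda>s' t'. I s' t' \<and> \<mu> s' < \<mu> s) s (t + (1 + bcost b))"
    and fin: "\<And>s t. frame p s0 s \<Longrightarrow> I s t \<Longrightarrow> \<not> bval b s \<Longrightarrow> Q s (t + (1 + bcost b))"
  shows "wp W (While b p) Q s0 t0"
proof -
  have "wp W (While b p) Q s t" if "frame p s0 s" "I s t" for s t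
    using that
  proof (induction "\<mu> s" arbitrary: s t rule: less_induct)
    case less
    show ?case
    proof (cases "bval b s")
      case True
      from body[OF less.prems True] obtain u s' where
        u: "exec W p s u s'" "I s' (t + (1 + bcost b) + u)" "\<mu> s' < \<mu> s"
        unfolding wp_def by auto
      have "frame p s0 s'"
        using exec_frame[OF u(1)] less.prems(1) frame_trans by blast
      from less.hyps[OF u(3) this u(2)] show ?thesis
        unfolding wp_def using exec.WhileTrue[OF safe[OF less.prems] True u(1)]
        by (metis add.assoc)
    next
      case False
      then show ?thesis
        unfolding wp_def using exec.WhileFalse[OF safe[OF less.prems] False] fin[OF less.prems False]
        by blast
    qed
  qed
  then show ?thesis using init by simp
qed

definition For :: "vname \<Rightarrow> aexp \<Rightarrow> vname \<Rightarrow> com \<Rightarrow> com" where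
  "For i e h p = Seq (Assign i e)
     (While (Less (Var i) (Var h)) (Seq p (Assign i (Bin Add (Var i) (Const 1)))))"

lemma written_For [simp]:
  "written_vars (For i e h p) = insert i (written_vars p)"
  "written_arrs (For i e h p) = written_arrs p"
  by (auto simp: For_def)

text \<open>The constants 4 are the cost of the test \<open>i < h\<close> and the cost of the
  increment of \<open>i\<close>. The invariant is taken just before the test, hence one more 4 for
  the last, failing test.\<close>

lemma wp_For:
  fixes a b :: nat
  assumes i: "i \<notin> written_vars p" and h: "h \<notin> written_vars p" "h \<noteq> i"
    and e: "asafe W e s0" "aval e s0 = int a" and b: "var s0 h = int b" "a \<le> b" "int b \<le> W" "1 \<le> W"
    and init: "I a (s0\<lparr>var := (var s0)(i := int a)\<rparr>) (t0 + (1 + acost e))"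
    and body: "\<And>j s t. a \<le> j \<Longrightarrow> j < b \<Longrightarrow> frame (For i e h p) s0 s \<Longrightarrow> var s i = int j \<Longrightarrow> I j s t \<Longrightarrow>
      wp W p (\<lambda>s' t'. I (Suc j) (s'\<lparr>var := (var s')(i := int j + 1)\<rparr>) (t' + 4)) s (t + 4)"
    and fin: "\<And>s t. frame (For i e h p) s0 s \<Longrightarrow> var s i = int b \<Longrightarrow> I b s t \<Longrightarrow> Q s (t + 4)"
  shows "wp W (For i e h p) Q s0 t0"
  unfolding For_def
proof (intro wp_Seq wp_Assign)
  define p' where "p' = Seq p (Assign i (Bin Add (Var i) (Const 1)))"
  let ?s = "s0\<lparr>var := (var s0)(i := aval e s0)\<rparr>"
  have fr: "frame (For i e h p) s0 s" if "frame p' ?s s" for s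
    using that by (auto simp: frame_def For_def p'_def)
  have vh: "var s h = int b" if "frame p' ?s s" for s
    using that h b(1) by (auto simp: frame_def p'_def)
  show "wp W (While (Less (Var i) (Var h)) (Seq p (Assign i (Bin Add (Var i) (Const 1))))) Q ?s (t0 + (1 + acost e))"
    unfolding p'_def[symmetric]
  proof (rule wp_While[where I = "\<lambda>s t. \<exists>j\<le>b. a \<le> j \<and> var s i = int j \<and> I j s t"
        and \<mu> = "\<lambda>s. b - nat (var s i)"])
    show "\<exists>j\<le>b. a \<le> j \<and> var ?s i = int j \<and> I j ?s (t0 + (1 + acost e))"
      using init e b by (intro exI[of _ a]) simp
  next
    fix s t assume "frame p' ?s s" "\<exists>j\<le>b. a \<le> j \<and> var s i = int j \<and> I j s t"
    then show "bsafe W (Less (Var i) (Var h)) s"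
      using vh b by auto
  next
    fix s t assume *: "frame p' ?s s" "\<exists>j\<le>b. a \<le> j \<and> var s i = int j \<and> I j s t"
      "bval (Less (Var i) (Var h)) s"
    then obtain j where j: "a \<le> j" "j < b" "var s i = int j" "I j s t"
      using vh by auto
    have "wp W p' (\<lambda>s' t'. I (Suc j) s' t' \<and> var s' i = int j + 1) s (t + 4)"
      unfolding p'_def
    proof (rule wp_Seq, rule wp_mono[OF body[OF j(1,2) fr[OF *(1)] j(3,4)]])
      fix s' t' assume "frame p s s'"
        "I (Suc j) (s'\<lparr>var := (var s')(i := int j + 1)\<rparr>) (t' + 4)"
      moreover from this(1) have "var s' i = int j" using i j by (simp add: frame_def)
      ultimately show "wp W (Assign i (Bin Add (Var i) (Const 1)))
          (\<lambda>s' t'. I (Suc j) s' t' \<and> var s' i = int j + 1) s' t'"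
        using b j by (intro wp_Assign) (auto simp: numeral_eq_Suc)
    qed
    then show "wp W p' (\<lambda>s' t'. (\<exists>j\<le>b. a \<le> j \<and> var s' i = int j \<and> I j s' t') \<and>
        b - nat (var s' i) < b - nat (var s i)) s (t + (1 + bcost (Less (Var i) (Var h))))"
      by (simp add: numeral_eq_Suc, elim wp_mono) (use j in \<open>auto intro!: exI[of _ "Suc j"]\<close>)
  next
    fix s t assume *: "frame p' ?s s" "\<exists>j\<le>b. a \<le> j \<and> var s i = int j \<and> I j s t"
      "\<not> bval (Less (Var i) (Var h)) s"
    then have "var s i = int b" "I b s t" using vh by (auto simp: not_less)
    from fin[OF fr[OF *(1)] this] show "Q s (t + (1 + bcost (Less (Var i) (Var h))))"
      by (simp add: numeral_eq_Suc)
  qed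
qed (use e in auto)

section \<open>Merging\<close>

text \<open>The blocks are the aligned intervals of length \<open>w\<close>, the last one cut off at
  \<open>n\<close>. Width 1 imposes no condition, and width at least \<open>n\<close> means sorted.
  Strictness is possible because the keys are distinct.\<close>

definition sorted_blocks :: "nat \<Rightarrow> nat \<Rightarrow> (nat \<Rightarrow> int) \<Rightarrow> bool" where
  "sorted_blocks w n X \<longleftrightarrow> (\<forall>p q. p < q \<longrightarrow> q < n \<longrightarrow> p div w = q div w \<longrightarrow> X p < X q)"

text \<open>The state of a merge pass from block width \<open>w\<close> to \<open>2 * w\<close>: the entries below \<open>k\<close> of \<open>Y\<close> are
  final, and the rest of the current block is obtained from the unread parts \<open>{p..<mid}\<close> and
  \<open>{q..<hi}\<close> of \<open>X\<close>.\<close>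

definition merging ::
    "nat \<Rightarrow> nat \<Rightarrow> (nat \<Rightarrow> int) \<Rightarrow> (nat \<Rightarrow> int) \<Rightarrow> nat \<Rightarrow> nat \<Rightarrow> nat \<Rightarrow> nat \<Rightarrow> nat \<Rightarrow> bool" where
  "merging n w X Y k p mid q hi \<longleftrightarrow>
     k \<le> hi \<and> hi \<le> n \<and> p \<le> mid \<and> mid \<le> q \<and> q \<le> hi \<and> k + mid = p + q \<and> (hi = n \<or> 2 * w dvd hi) \<and>
     sorted_blocks (2 * w) k Y \<and> Y ` {..<k} = X ` ({..<p} \<union> {mid..<q}) \<and>
     strict_mono_on {p..<mid} X \<and> strict_mono_on {q..<hi} X \<and>
     (\<exists>lo\<le>p. 2 * w dvd lo \<and> hi \<le> lo + 2 * w \<and>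
        (\<forall>r. lo \<le> r \<and> r < k \<longrightarrow> (p < mid \<longrightarrow> Y r < X p) \<and> (q < hi \<longrightarrow> Y r < X q)))"

text \<open>With \<open>hi = 0 = k\<close> a pass begins as if an empty block had just been
  finished, so the first iteration opens the first block by the same test as all later ones.\<close>

lemma merging_init: "merging n w X Y 0 0 0 0 0"
  by (auto simp: merging_def sorted_blocks_def)

lemma strict_mono_on_block:
  assumes "sorted_blocks w n X" "w dvd a" "b \<le> a + w" "b \<le> n"
  shows "strict_mono_on {a..<b} X"
proof (rule strict_mono_onI)
  fix p q assume pq: "p \<in> {a..<b}" "q \<in> {a..<b}" "p < q"
  obtain c where c: "a = w * c" using assms(2) by blast
  have "x div w = c" if "x \<in> {a..<b}" for x
    using that assms(3) unfolding c by (intro div_nat_eqI) auto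
  then show "X p < X q" using pq assms(1,4) unfolding sorted_blocks_def by auto
qed

text \<open>At \<open>k = hi\<close> the equation \<open>k + mid = p + q\<close> together with
  \<open>p \<le> mid\<close> and \<open>q \<le> hi\<close> forces both runs to be exhausted. As
  \<open>k < n\<close>, this end is a multiple of \<open>2 * w\<close>, so the next two blocks of
  width \<open>w\<close> are aligned; near the end of the array the second one may be empty.\<close>

lemma merging_start:
  assumes "sorted_blocks w n X" "merging n w X Y k p mid q k" "k < n"
  shows "merging n w X Y k k (min (k + w) n) (min (k + w) n) (min (k + 2 * w) n)"
proof -
  have k: "2 * w dvd k" and sb: "sorted_blocks (2 * w) k Y"
    and eqs: "p = mid" "q = k" and im: "Y ` {..<k} = X ` ({..<p} \<union> {mid..<q})"
    using assms by (auto simp: merging_def)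
  have "{..<p} \<union> {mid..<q} = {..<k}"
    using eqs assms(2) by (auto simp: merging_def)
  moreover have "w dvd k" using k by (rule dvd_mult_right)
  then have "w dvd k + w" by simp
  then have "strict_mono_on {k..<min (k + w) n} X"
    "strict_mono_on {min (k + w) n..<min (k + 2 * w) n} X"
    using \<open>w dvd k\<close> by (cases "k + w \<le> n"; auto intro!: strict_mono_on_block[OF assms(1)])+
  moreover have "min (k + 2 * w) n = n \<or> 2 * w dvd min (k + 2 * w) n"
    using k by (auto simp: min_def)
  ultimately show ?thesis
    using im sb k assms(3) unfolding merging_def by (auto intro!: exI[of _ k])
qed

text \<open>The multiple \<open>lo\<close> of \<open>w\<close> lies at or before the beginning of
  the block of \<open>k\<close>, so every earlier entry of that block has index at least
  \<open>lo\<close> and is below \<open>x\<close> by hypothesis.\<close>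

lemma sorted_blocks_Suc:
  assumes "sorted_blocks w k Y" "w dvd lo" "lo \<le> k" "\<forall>r. lo \<le> r \<and> r < k \<longrightarrow> Y r < x"
  shows "sorted_blocks w (Suc k) (Y(k := x))"
  unfolding sorted_blocks_def
proof (intro allI impI)
  fix r s assume rs: "r < s" "s < Suc k" "r div w = s div w"
  show "(Y(k := x)) r < (Y(k := x)) s"
  proof (cases "s = k")
    case True
    have "lo = lo div w * w" using assms(2) by simp
    also have "\<dots> \<le> k div w * w" using assms(3) by (intro mult_le_mono1 div_le_mono)
    also have "\<dots> = r div w * w" using rs True by simp
    also have "\<dots> \<le> r" by simp
    finally show ?thesis using assms(4) rs True by auto
  next
    case False
    then show ?thesis using rs assms(1) by (auto simp: sorted_blocks_def)
  qed
qed

text \<open>The entry written, \<open>X p\<close>, is below both heads that remain: below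
  \<open>X (Suc p)\<close> because the left run is increasing, and below \<open>X q\<close> by the
  hypothesis on the comparison. \<open>merging_right\<close> is the mirror image.\<close>

lemma merging_left:
  assumes m: "merging n w X Y k p mid q hi" and p: "p < mid" and less: "q < hi \<Longrightarrow> X p < X q"
  shows "merging n w X (Y(k := X p)) (Suc k) (Suc p) mid q hi"
proof -
  from m obtain lo where lo: "lo \<le> p" "2 * w dvd lo" "hi \<le> lo + 2 * w"
    "\<forall>r. lo \<le> r \<and> r < k \<longrightarrow> (p < mid \<longrightarrow> Y r < X p) \<and> (q < hi \<longrightarrow> Y r < X q)"
    unfolding merging_def by blast
  have eqs: "k + mid = p + q" "mid \<le> q" and sb: "sorted_blocks (2 * w) k Y"
    and im: "Y ` {..<k} = X ` ({..<p} \<union> {mid..<q})" and mono: "strict_mono_on {p..<mid} X"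
    using m by (auto simp: merging_def)
  have "sorted_blocks (2 * w) (Suc k) (Y(k := X p))"
    using lo eqs p by (intro sorted_blocks_Suc[OF sb, of lo]) auto
  moreover have "(Y(k := X p)) ` {..<Suc k} = insert (X p) (Y ` {..<k})"
    by (auto simp: lessThan_Suc)
  then have "(Y(k := X p)) ` {..<Suc k} = X ` ({..<Suc p} \<union> {mid..<q})"
    unfolding im by (auto simp: lessThan_Suc)
  moreover have "strict_mono_on {Suc p..<mid} X"
    using mono by (rule monotone_on_subset) auto
  moreover have "\<forall>r. lo \<le> r \<and> r < Suc k \<longrightarrow> (Suc p < mid \<longrightarrow> (Y(k := X p)) r < X (Suc p)) \<and>
      (q < hi \<longrightarrow> (Y(k := X p)) r < X q)"
    using lo p less strict_mono_onD[OF mono, of p "Suc p"] by (fastforce simp: less_Suc_eq)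
  ultimately show ?thesis
    using m p lo unfolding merging_def by (auto intro!: exI[of _ lo])
qed

lemma merging_right:
  assumes m: "merging n w X Y k p mid q hi" and q: "q < hi" and less: "p < mid \<Longrightarrow> X q < X p"
  shows "merging n w X (Y(k := X q)) (Suc k) p mid (Suc q) hi"
proof -
  from m obtain lo where lo: "lo \<le> p" "2 * w dvd lo" "hi \<le> lo + 2 * w"
    "\<forall>r. lo \<le> r \<and> r < k \<longrightarrow> (p < mid \<longrightarrow> Y r < X p) \<and> (q < hi \<longrightarrow> Y r < X q)"
    unfolding merging_def by blast
  have eqs: "k + mid = p + q" "mid \<le> q" "p \<le> mid" and sb: "sorted_blocks (2 * w) k Y"
    and im: "Y ` {..<k} = X ` ({..<p} \<union> {mid..<q})" and mono: "strict_mono_on {q..<hi} X"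
    using m by (auto simp: merging_def)
  have "sorted_blocks (2 * w) (Suc k) (Y(k := X q))"
    using lo eqs q by (intro sorted_blocks_Suc[OF sb, of lo]) auto
  moreover have "(Y(k := X q)) ` {..<Suc k} = insert (X q) (Y ` {..<k})"
    by (auto simp: lessThan_Suc)
  then have "(Y(k := X q)) ` {..<Suc k} = X ` ({..<p} \<union> {mid..<Suc q})"
    using eqs unfolding im by (auto simp: atLeastLessThanSuc)
  moreover have "strict_mono_on {Suc q..<hi} X"
    using mono by (rule monotone_on_subset) auto
  moreover have "\<forall>r. lo \<le> r \<and> r < Suc k \<longrightarrow> (p < mid \<longrightarrow> (Y(k := X q)) r < X p) \<and>
      (Suc q < hi \<longrightarrow> (Y(k := X q)) r < X (Suc q))"
    using lo q less strict_mono_onD[OF mono, of q "Suc q"] by (fastforce simp: less_Suc_eq)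
  ultimately show ?thesis
    using m q lo unfolding merging_def by (auto intro!: exI[of _ lo])
qed

section \<open>The sorting program\<close>

datatype register = Len | Chars | Keys | Aux | Idx | Idx2 | Width | Rounds |
  LeftPos | LeftEnd | RightPos | RightEnd | GroupStart | GroupEnd | Letter | Total

text \<open>Countability supplies the injection \<open>to_nat\<close>, from which
  \<open>ex_fresh_names\<close> builds distinct names.\<close>

instance register :: countable
  by countable_datatype

text \<open>The convolution program \<open>conv\<close> may overwrite any variable it mentions, so all data that
  has to survive it is kept under names \<open>v r\<close> that \<open>conv\<close> does not use.\<close>

locale fresh_names =
  fixes v :: "register \<Rightarrow> vname" and conv :: com
  assumes v_inj: "inj v"
    and v_fresh: "v r \<notin> {''n'', ''S'', ''m'', ''a'', ''b'', ''c'', ''count''}"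
      "v r \<notin> written_vars conv" "v r \<notin> written_arrs conv"
begin

lemma v_simps [simp]:
  "v r = v r' \<longleftrightarrow> r = r'"
  "v r \<noteq> ''n''" "v r \<noteq> ''S''" "v r \<noteq> ''m''" "v r \<noteq> ''a''" "v r \<noteq> ''b''" "v r \<noteq> ''c''" "v r \<noteq> ''count''"
  "''n'' \<noteq> v r" "''S'' \<noteq> v r" "''m'' \<noteq> v r" "''a'' \<noteq> v r" "''b'' \<noteq> v r" "''c'' \<noteq> v r" "''count'' \<noteq> v r"
  "v r \<notin> written_vars conv" "v r \<notin> written_arrs conv"
  using v_fresh(1)[of r] v_fresh(2,3) inj_eq[OF v_inj] by auto

abbreviation "V r \<equiv> Var (v r)"
abbreviation "R a e \<equiv> Read (v a) e"

definition set_min :: "register \<Rightarrow> aexp \<Rightarrow> com" where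
  "set_min x e = If (Less e (V Len)) (Assign (v x) e) (Assign (v x) (V Len))"

definition start_block :: com where
  "start_block =
     Seq (Assign (v LeftPos) (V Idx))
    (Seq (set_min LeftEnd (Bin Add (V Idx) (V Width)))
    (Seq (Assign (v RightPos) (V LeftEnd))
         (set_min RightEnd (Bin Add (V Idx) (Bin Mul (Const 2) (V Width))))))"

definition merge_step :: com where
  "merge_step =
     If (And (Less (V LeftPos) (V LeftEnd))
          (Not (And (Less (V RightPos) (V RightEnd))
                    (Less (R Keys (V RightPos)) (R Keys (V LeftPos))))))
       (Seq (Store (v Aux) (V Idx) (R Keys (V LeftPos)))
            (Assign (v LeftPos) (Bin Add (V LeftPos) (Const 1))))
       (Seq (Store (v Aux) (V Idx) (R Keys (V RightPos)))
            (Assign (v RightPos) (Bin Add (V RightPos) (Const 1))))"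

definition merge_pass :: com where
  "merge_pass =
     Seq (Assign (v LeftPos) (Const 0))
    (Seq (Assign (v LeftEnd) (Const 0))
    (Seq (Assign (v RightPos) (Const 0))
    (Seq (Assign (v RightEnd) (Const 0))
         (For (v Idx) (Const 0) (v Len)
           (Seq (If (Eq (V Idx) (V RightEnd)) start_block Skip) merge_step)))))"

definition copy_back :: com where
  "copy_back = For (v Idx) (Const 0) (v Len) (Store (v Keys) (V Idx) (R Aux (V Idx)))"

definition sort_keys :: com where
  "sort_keys =
     Seq (Assign (v Width) (Const 1))
    (Seq (Assign (v Rounds) (Const 0))
         (While (Less (V Width) (V Len))
           (Seq merge_pass
           (Seq copy_back
           (Seq (Assign (v Width) (Bin Mul (Const 2) (V Width)))
                (Assign (v Rounds) (Bin Add (V Rounds) (Const 1))))))))"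

text \<open>The entry behind the last key gets a value because the initial memory is arbitrary and
  reading a number beyond the word bound would be stuck: both \<open>merge_step\<close> and the
  guard in \<open>find_group\<close> may read index \<open>n\<close>, although the outcome does not
  depend on the value there.\<close>

definition load_input :: com where
  "load_input =
     Seq (For (v Idx) (Const 0) (v Len)
           (Seq (Store (v Chars) (V Idx) (Read ''S'' (V Idx)))
                (Store (v Keys) (V Idx) (Bin Add (Bin Mul (Read ''S'' (V Idx)) (V Len)) (V Idx)))))
         (Store (v Keys) (V Len) (Const 0))"

text \<open>\<open>merge_step\<close> evaluates both conjuncts of its condition, so \<open>Keys\<close> is also read at index \<open>n\<close>:
  hence the bound on the entry \<open>n\<close>.\<close>

lemma wp_merge_pass:
  fixes n w :: nat
  assumes len: "var s (v Len) = int n" and width: "var s (v Width) = int w" "0 < w" "w < n"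
    and W: "4 * int n + 8 \<le> W"
    and X: "X = arr s (v Keys)" "\<And>i. i \<le> n \<Longrightarrow> \<bar>X i\<bar> \<le> W" "inj_on X {..<n}" "sorted_blocks w n X"
    and Q: "\<And>s' t'. frame merge_pass s s' \<Longrightarrow> t' \<le> t + 80 * n + 24 \<Longrightarrow>
      sorted_blocks (2 * w) n (arr s' (v Aux)) \<Longrightarrow> arr s' (v Aux) ` {..<n} = X ` {..<n} \<Longrightarrow> Q s' t'"
  shows "wp W merge_pass Q s t"
proof -
  define I where "I = (\<lambda>k (s' :: state) t'. t' \<le> t + 20 + 80 * k \<and>
    (\<exists>p mid q hi. var s' (v LeftPos) = int p \<and> var s' (v LeftEnd) = int mid \<and>
      var s' (v RightPos) = int q \<and> var s' (v RightEnd) = int hi \<and>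
      merging n w X (arr s' (v Aux)) k p mid q hi))"
  \<comment> \<open>\<open>P\<close> describes the point between the two halves of the loop body,
    where \<open>k < hi\<close> guarantees an unread key. Opening a block is charged 44 operations
    in every iteration, whether or not it happens.\<close>
  define P where "P = (\<lambda>k p mid q hi (s' :: state) t' t0. t' \<le> t0 + (44::nat) \<and> var s' (v Idx) = int k \<and>
      var s' (v LeftPos) = int p \<and> var s' (v LeftEnd) = int mid \<and> arr s' (v Keys) = X \<and>
      var s' (v RightPos) = int q \<and> var s' (v RightEnd) = int hi \<and> k < hi \<and>
      merging n w X (arr s' (v Aux)) k p mid q hi)"
  have I_intro: "I k' s' t'"
    if "merging n w X (arr s' (v Aux)) k' p mid q hi" "t' \<le> t + 20 + 80 * k'"
      "var s' (v LeftPos) = int p" "var s' (v LeftEnd) = int mid"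
      "var s' (v RightPos) = int q" "var s' (v RightEnd) = int hi" for k' s' t' p mid q hi
    unfolding I_def using that by blast
  have step: "wp W merge_step (\<lambda>s' t'. I (Suc k) (s'\<lparr>var := (var s')(v Idx := int k + 1)\<rparr>) (t' + 4)) s' t'"
    if P: "P k p mid q hi s' t' (t + 24 + 80 * k)" for k p mid q hi s' t'
  proof -
    have m: "merging n w X (arr s' (v Aux)) k p mid q hi" and k: "k < hi"
      and rd: "var s' (v LeftPos) = int p" "var s' (v LeftEnd) = int mid"  "arr s' (v Keys) = X"
        "var s' (v RightPos) = int q" "var s' (v RightEnd) = int hi" "var s' (v Idx) = int k"
      and t': "t' \<le> t + 24 + 80 * k + 44"
      using P unfolding P_def by auto
    have le: "p \<le> mid" "mid \<le> q" "q \<le> hi" "hi \<le> n" "k + mid = p + q"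
      using m unfolding merging_def by auto
    \<comment> \<open>Distinct keys turn a failed test \<open>X q < X p\<close> into
      \<open>X p < X q\<close>, as the strict order in \<open>merging\<close> requires.\<close>
    have inj: "X p \<noteq> X q" if "p < mid" "q < hi"
      using inj_onD[OF X(3), of p q] le that by auto
    have bd: "\<bar>X p\<bar> \<le> W" "\<bar>X q\<bar> \<le> W" using le X(2) by auto
    have l: "merging n w X ((arr s' (v Aux))(k := X p)) (Suc k) (Suc p) mid q hi"
      if "p < mid" "\<not> (q < hi \<and> X q < X p)"
      using that inj by (intro merging_left[OF m]) auto
    have r: "merging n w X ((arr s' (v Aux))(k := X q)) (Suc k) p mid (Suc q) hi"
      if "\<not> (p < mid \<and> \<not> (q < hi \<and> X q < X p))"
      using that inj le k by (intro merging_right[OF m]) auto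
    show ?thesis
      unfolding merge_step_def
    proof (intro wp_intros, goal_cases)
      case 6
      then show ?case using rd l t' by (intro I_intro[where p = "Suc p" and mid = mid and q = q and hi = hi]) auto
    next
      case 11
      then show ?case using rd r t' by (intro I_intro[where p = p and mid = mid and q = "Suc q" and hi = hi]) auto
    qed (use rd bd W le k in auto)
  qed
  have start: "wp W (If (Eq (V Idx) (V RightEnd)) start_block Skip)
      (\<lambda>s' t'. \<exists>p mid q hi. P k p mid q hi s' t' (t + 24 + 80 * k)) s' (t' + 4)"
    if "I k s' t'" "k < n" "var s' (v Idx) = int k" "var s' (v Len) = int n"  "var s' (v Width) = int w"
       "arr s' (v Keys) = X" for k s' t'
  proof -
    from that(1) obtain p mid q hi where m: "merging n w X (arr s' (v Aux)) k p mid q hi"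
      and t': "t' \<le> t + 20 + 80 * k"
      and rd: "var s' (v LeftPos) = int p" "var s' (v LeftEnd) = int mid"
        "var s' (v RightPos) = int q" "var s' (v RightEnd) = int hi"
      unfolding I_def by blast
    have le: "hi \<le> n" "k \<le> hi" using m unfolding merging_def by auto
    show ?thesis
    proof (cases "k = hi")
      case True
      have ms: "merging n w X (arr s' (v Aux)) k k (min (k + w) n) (min (k + w) n) (min (k + 2 * w) n)"
        using merging_start[OF X(4)] m that(2) True by blast
      have rd4: "var s' (v RightEnd) = int k" using rd(4) True by simp
      define mid' hi' where "mid' = min (k + w) n" and "hi' = min (k + 2 * w) n"
      have ms': "merging n w X (arr s' (v Aux)) k k mid' mid' hi'" "k < hi'"
        using ms that(2) width(2) by (auto simp: mid'_def hi'_def)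
      have set_min: "wp W (set_min x e) Q' s2 t2"
        if "asafe W e s2" "var s2 (v Len) = int n"
          "\<And>t3. t3 \<le> t2 + 6 + 2 * acost e \<Longrightarrow>
             Q' (s2\<lparr>var := (var s2)(v x := (if aval e s2 < int n then aval e s2 else int n))\<rparr>) t3"
        for x e s2 t2 Q'
        unfolding set_min_def using that W
        by (intro wp_intros) (auto split: if_splits)
      have "wp W start_block (\<lambda>s' t'. P k k mid' mid' hi' s' t' (t + 24 + 80 * k)) s' (t' + 8)"
        unfolding start_block_def
        apply (intro wp_Seq wp_Assign set_min)
        using that(2-) rd(1-3) rd4 width(2,3) W ms' t'
        apply (simp_all add: P_def)
        by (auto simp: mid'_def hi'_def)
      then have "wp W start_block (\<lambda>s' t'. \<exists>p mid q hi. P k p mid q hi s' t' (t + 24 + 80 * k)) s' (t' + 8)"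
        by (rule wp_mono) blast
      then show ?thesis
        using rd W le that True by (intro wp_If) (auto simp: add.commute)
    next
      case False
      then show ?thesis
        using that rd W le t' m by (intro wp_intros) (auto simp: P_def intro!: exI)
    qed
  qed
  have body: "wp W (Seq (If (Eq (V Idx) (V RightEnd)) start_block Skip) merge_step)
      (\<lambda>s' t'. I (Suc k) (s'\<lparr>var := (var s')(v Idx := int k + 1)\<rparr>) (t' + 4)) s' (t' + 4)"
    if "I k s' t'" "k < n" "var s' (v Idx) = int k" "var s' (v Len) = int n"  "var s' (v Width) = int w"
       "arr s' (v Keys) = X" for k s' t'
    by (intro wp_Seq wp_mono[OF start[OF that]]) (auto intro: step)
  have fin: "t' + 4 \<le> t + 80 * n + 24 \<and> sorted_blocks (2 * w) n (arr s' (v Aux)) \<and>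
      arr s' (v Aux) ` {..<n} = X ` {..<n}" if "I n s' t'" for s' t'
  proof -
    from that obtain p mid q hi where m: "merging n w X (arr s' (v Aux)) n p mid q hi"
      and t': "t' \<le> t + 20 + 80 * n"
      unfolding I_def by blast
    \<comment> \<open>At \<open>k = n\<close> also \<open>hi = n\<close>, so both runs are
      exhausted: \<open>p = mid\<close> and \<open>q = n\<close>.\<close>
    have "{..<p} \<union> {mid..<q} = {..<n}"
      using m by (auto simp: merging_def)
    then show ?thesis using m t' by (auto simp: merging_def)
  qed
  have "wp W merge_pass (\<lambda>s' t'. t' \<le> t + 80 * n + 24 \<and> sorted_blocks (2 * w) n (arr s' (v Aux)) \<and>
      arr s' (v Aux) ` {..<n} = X ` {..<n}) s t"
    unfolding merge_pass_def
    by (intro wp_Seq wp_Assign wp_For[where I = I and a = 0 and b = n] body fin)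
      (use W len width in \<open>auto simp: start_block_def merge_step_def set_min_def X(1) frame_def I_def merging_init\<close>)
  then show ?thesis
    by (rule wp_mono) (use Q in auto)
qed

lemma wp_copy_back:
  fixes n :: nat
  assumes len: "var s (v Len) = int n" and W: "4 * int n + 8 \<le> W"
    and Y: "\<And>i. i < n \<Longrightarrow> \<bar>arr s (v Aux) i\<bar> \<le> W"
    and Q: "\<And>s' t'. frame copy_back s s' \<Longrightarrow> t' \<le> t + 12 * n + 10 \<Longrightarrow>
      (\<And>i. arr s' (v Keys) i = (if i < n then arr s (v Aux) i else arr s (v Keys) i)) \<Longrightarrow> Q s' t'"
  shows "wp W copy_back Q s t"
proof -
  define I where "I = (\<lambda>k (s' :: state) t'. t' \<le> t + 2 + 12 * k \<and> arr s' (v Aux) = arr s (v Aux) \<and>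
    (\<forall>i. arr s' (v Keys) i = (if i < k then arr s (v Aux) i else arr s (v Keys) i)))"
  have "wp W copy_back (\<lambda>s' t'. I n s' (t' - 4) \<and> 4 \<le> t') s t"
    unfolding copy_back_def
    by (intro wp_For[where I = I and a = 0 and b = n] wp_Store)
      (use len W Y in \<open>auto simp: I_def\<close>)
  then show ?thesis
    by (rule wp_mono) (use Q in \<open>auto simp: I_def\<close>)
qed

text \<open>The two hypotheses on \<open>r\<close> say that it is the binary logarithm of
  \<open>n\<close> rounded up. After \<open>k\<close> rounds the width is \<open>2 ^ k\<close>, so
  the loop stops after exactly \<open>r\<close> rounds; each costs \<open>O(n)\<close>, the additive
  constants being absorbed by \<open>n\<close>.\<close>

lemma wp_sort_keys:
  fixes n r :: nat
  assumes len: "var s (v Len) = int n" and n: "2 \<le> n" and W: "4 * int n + 8 \<le> W"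
    and X: "X = arr s (v Keys)" "\<And>i. i \<le> n \<Longrightarrow> \<bar>X i\<bar> \<le> W" "inj_on X {..<n}"
    and r: "n \<le> 2 ^ r" "2 ^ (r - 1) < n"
    and Q: "\<And>s' t'. frame sort_keys s s' \<Longrightarrow> t' \<le> t + 150 * (n * r) + 20 \<Longrightarrow> var s' (v Rounds) = int r \<Longrightarrow>
      strict_mono_on {..<n} (arr s' (v Keys)) \<Longrightarrow> arr s' (v Keys) ` {..<n} = X ` {..<n} \<Longrightarrow>
      arr s' (v Keys) n = X n \<Longrightarrow> Q s' t'"
  shows "wp W sort_keys Q s t"
proof -
  define I where "I = (\<lambda>(s' :: state) t'. \<exists>k\<le>r. t' \<le> t + 10 + 150 * (n * k) \<and>
    var s' (v Rounds) = int k \<and> var s' (v Width) = int (2 ^ k) \<and>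
    sorted_blocks (2 ^ k) n (arr s' (v Keys)) \<and> arr s' (v Keys) ` {..<n} = X ` {..<n} \<and>
    arr s' (v Keys) n = X n)"
  have rn: "r \<le> n"
  proof -
    have "r - 1 < 2 ^ (r - 1)" by (rule less_exp)
    with r(2) show ?thesis by linarith
  qed
  have "wp W sort_keys (\<lambda>s' t'. t' \<le> t + 150 * (n * r) + 20 \<and> var s' (v Rounds) = int r \<and>
      strict_mono_on {..<n} (arr s' (v Keys)) \<and> arr s' (v Keys) ` {..<n} = X ` {..<n} \<and>
      arr s' (v Keys) n = X n) s t"
    unfolding sort_keys_def
  proof (intro wp_Seq wp_Assign wp_While[where I = I and \<mu> = "\<lambda>s. r - nat (var s (v Rounds))"], goal_cases)
    case 3
    then show ?case by (auto simp: I_def X(1) sorted_blocks_def)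
  next
    case (4 s1 t1)
    then obtain k where k: "k \<le> r" "var s1 (v Width) = int (2 ^ k)"
      by (auto simp: I_def)
    \<comment> \<open>The last width may exceed \<open>n\<close>, but it is below
      \<open>2 * n\<close> because \<open>2 ^ (r - 1) < n\<close>; hence it still fits into a
      word.\<close>
    have "(2 :: nat) ^ k \<le> 2 * n"
    proof -
      have "(2 :: nat) ^ k \<le> 2 ^ r" using k by simp
      also have "\<dots> \<le> 2 * 2 ^ (r - 1)" by (cases r) auto
      finally show ?thesis using r(2) by linarith
    qed
    then have "int (2 ^ k) \<le> 2 * int n" by linarith
    then show ?case using 4(1) W k len by (auto simp: frame_def merge_pass_def copy_back_def start_block_def
          set_min_def merge_step_def)
  next
    case (5 s1 t1)
    then have rd: "var s1 (v Len) = int n" 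
      using len by (auto simp: frame_def merge_pass_def copy_back_def start_block_def
          set_min_def merge_step_def)
    from 5 obtain k where k: "k \<le> r" "t1 \<le> t + 10 + 150 * (n * k)" "var s1 (v Rounds) = int k"
      "var s1 (v Width) = int (2 ^ k)" "sorted_blocks (2 ^ k) n (arr s1 (v Keys))"
      "arr s1 (v Keys) ` {..<n} = X ` {..<n}" "arr s1 (v Keys) n = X n"
      by (auto simp: I_def)
    have wn: "2 ^ k < n" using 5 rd k(4) by simp
    then have wn': "(2 :: int) ^ k < int n"
      by (metis of_nat_less_iff of_nat_numeral of_nat_power)
    then have wW: "2 * (2 :: int) ^ k \<le> W" "(2 :: int) ^ k \<le> W"
      using W zero_le_power[of "2 :: int" k] by linarith+
    from wn have kr: "k < r" using r(1) k(1) by (cases "k = r") auto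
    \<comment> \<open>The previous rounds kept the set of keys, which has \<open>n\<close> elements;
      so the \<open>n\<close> entries are still distinct.\<close>
    have inj: "inj_on (arr s1 (v Keys)) {..<n}"
      using X(3) k(6) by (intro eq_card_imp_inj_on) (auto simp: card_image)
    have bd: "\<bar>y\<bar> \<le> W" if "y \<in> X ` {..<n}" for y using that X(2) by auto
    have bd': "\<bar>arr s1 (v Keys) i\<bar> \<le> W" if "i \<le> n" for i
      using that k(6,7) X(2)[of n] bd[of "arr s1 (v Keys) i"]
        imageI[of i "{..<n}" "arr s1 (v Keys)"] by (cases "i = n") auto
    show ?case
    proof (rule wp_merge_pass[OF rd k(4) _ wn W refl bd' inj k(5)], simp, assumption)
      fix s2 t2 assume s2: "frame merge_pass s1 s2"
        "t2 \<le> t1 + (1 + bcost (Less (V Width) (V Len))) + 80 * n + 24"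
        "sorted_blocks (2 * 2 ^ k) n (arr s2 (v Aux))"
        "arr s2 (v Aux) ` {..<n} = arr s1 (v Keys) ` {..<n}"
      have rd2: "var s2 (v Len) = int n" "var s2 (v Rounds) = int k" "var s2 (v Width) = int (2 ^ k)"
        "arr s2 (v Keys) = arr s1 (v Keys)"
        using s2(1) rd k(3,4) by (auto simp: frame_def merge_pass_def copy_back_def start_block_def
          set_min_def merge_step_def)
      have bd2: "\<bar>arr s2 (v Aux) i\<bar> \<le> W" if "i < n" for i
        using that s2(4) k(6) bd[of "arr s2 (v Aux) i"] by auto
      show "wp W (Seq copy_back (Seq (Assign (v Width) (Bin Mul (Const 2) (V Width)))
                (Assign (v Rounds) (Bin Add (V Rounds) (Const 1)))))
          (\<lambda>s' t'. I s' t' \<and> r - nat (var s' (v Rounds)) < r - nat (var s1 (v Rounds))) s2 t2"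
      proof (intro wp_Seq wp_Assign wp_copy_back[OF rd2(1) W bd2], goal_cases)
        case (4 s3 t3)
        have im: "arr s3 (v Keys) ` {..<n} = arr s2 (v Aux) ` {..<n}"
          using 4(3) by (intro image_cong) auto
        have sb: "sorted_blocks (2 ^ Suc k) n (arr s3 (v Keys))"
          using s2(3) 4(3) by (auto simp: sorted_blocks_def)
        have tm: "n * Suc k = n * k + n" by simp
        have rd3: "var s3 (v Rounds) = int k" "var s3 (v Width) = int (2 ^ k)"
          using 4(1) rd2 by (auto simp: frame_def copy_back_def)
        show ?case
          unfolding I_def
          using 4(2,3) im sb tm rd3 kr s2(2,4) k(2,3,6,7) rd2 n by (auto intro!: exI[of _ "Suc k"])
      qed (use rd2 wW W kr rn in \<open>auto simp: frame_def copy_back_def\<close>)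
    qed
  next
    case (6 s1 t1)
    then have rd: "var s1 (v Len) = int n" 
      using len by (auto simp: frame_def merge_pass_def copy_back_def start_block_def
          set_min_def merge_step_def)
    from 6 obtain k where k: "k \<le> r" "t1 \<le> t + 10 + 150 * (n * k)" "var s1 (v Rounds) = int k"
      "var s1 (v Width) = int (2 ^ k)" "sorted_blocks (2 ^ k) n (arr s1 (v Keys))"
      "arr s1 (v Keys) ` {..<n} = X ` {..<n}" "arr s1 (v Keys) n = X n"
      by (auto simp: I_def)
    have wn: "n \<le> 2 ^ k" using 6 rd k(4) by simp
    have "k = r"
    proof (rule ccontr)
      assume "k \<noteq> r"
      with k(1) have "k \<le> r - 1" by simp
      then have "(2 :: nat) ^ k \<le> 2 ^ (r - 1)" by (rule power_increasing) simp
      with r(2) wn show False by linarith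
    qed
    moreover have "strict_mono_on {..<n} (arr s1 (v Keys))"
      using k(5) wn by (intro strict_mono_onI) (auto simp: sorted_blocks_def)
    ultimately show ?case using k by simp
  qed (use W n in auto)
  then show ?thesis
    by (rule wp_mono) (use Q in auto)
qed

lemma wp_load_input:
  fixes S :: "int list"
  assumes len: "var s (v Len) = int (length S)" and W: "4 * int (length S) + 8 \<le> W"
    and S: "array_holds s ''S'' S"
    and bd: "\<And>x. x \<in> set S \<Longrightarrow> \<bar>x\<bar> * int (length S) + int (length S) \<le> W"
    and Q: "\<And>s' t'. frame load_input s s' \<Longrightarrow> t' \<le> t + 30 * length S + 15 \<Longrightarrow>
      array_holds s' (v Chars) S \<Longrightarrow>
      (\<And>i. i < length S \<Longrightarrow> arr s' (v Keys) i = S ! i * int (length S) + int i) \<Longrightarrow>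
      arr s' (v Keys) (length S) = 0 \<Longrightarrow> Q s' t'"
  shows "wp W load_input Q s t"
proof -
  define n where "n = length S"
  define I where "I = (\<lambda>k (s' :: state) t'. t' \<le> t + 2 + 30 * k \<and>
    (\<forall>i<k. arr s' (v Chars) i = S ! i) \<and> (\<forall>i<k. arr s' (v Keys) i = S ! i * int n + int i))"
  have bd': "\<bar>S ! i\<bar> \<le> W" "\<bar>S ! i * int n\<bar> \<le> W" "\<bar>S ! i * int n + int i\<bar> \<le> W" if "i < n" for i
  proof -
    have "\<bar>S ! i\<bar> * int n + int n \<le> W"
      using bd[of "S ! i"] that by (auto simp: n_def)
    moreover have "\<bar>S ! i * int n\<bar> = \<bar>S ! i\<bar> * int n" by (simp add: abs_mult)
    moreover have "\<bar>S ! i\<bar> * 1 \<le> \<bar>S ! i\<bar> * int n"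
      using that by (intro mult_left_mono) auto
    ultimately show "\<bar>S ! i\<bar> \<le> W" "\<bar>S ! i * int n\<bar> \<le> W" "\<bar>S ! i * int n + int i\<bar> \<le> W"
      using that by linarith+
  qed
  have "wp W load_input (\<lambda>s' t'. t' \<le> t + 30 * n + 15 \<and> array_holds s' (v Chars) S \<and>
      (\<forall>i<n. arr s' (v Keys) i = S ! i * int n + int i) \<and> arr s' (v Keys) n = 0) s t"
    unfolding load_input_def
  proof (intro wp_Seq wp_Assign wp_Store wp_For[where I = I and a = 0 and b = n])
  qed (use len W S bd' in \<open>auto simp: I_def n_def[symmetric] array_holds_def frame_def less_Suc_eq nth_append\<close>)
  then show ?thesis
    by (rule wp_mono) (use Q in \<open>auto simp: n_def\<close>)
qed

end

section \<open>Counting letter by letter\<close>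

definition occurrences :: "'a list \<Rightarrow> 'a \<Rightarrow> nat set" where
  "occurrences S a = {i. i < length S \<and> S ! i = a}"

text \<open>A sub-cadence is coded by its zero-based first and third positions. The middle position
  is then their midpoint, which has to be an integer and to carry the same letter.\<close>

definition letter_pairs :: "'a list \<Rightarrow> 'a \<Rightarrow> (nat \<times> nat) set" where
  "letter_pairs S a = {(p, q) \<in> occurrences S a \<times> occurrences S a.
     p < q \<and> even (p + q) \<and> S ! ((p + q) div 2) = a}"

lemma finite_occurrences [simp]: "finite (occurrences S a)"
  by (simp add: occurrences_def)

lemma letter_pairs_subset: "letter_pairs S a \<subseteq> occurrences S a \<times> occurrences S a"
  by (auto simp: letter_pairs_def)

lemma finite_letter_pairs [simp]: "finite (letter_pairs S a)"
  by (rule finite_subset[OF letter_pairs_subset]) simp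

text \<open>The pair \<open>(p, q)\<close> corresponds to the triple with start \<open>p + 1\<close>
  (positions in triples count from 1) and distance \<open>(q - p) div 2\<close>. The sets for
  different letters are disjoint because \<open>p\<close> carries the letter.\<close>

lemma card_three_sub_cadences:
  "card (three_sub_cadences S) = (\<Sum>a\<in>set S. card (letter_pairs S a))"
proof -
  have "bij_betw (\<lambda>(p, q). (p + 1, (q - p) div 2, 3)) (\<Union>a\<in>set S. letter_pairs S a) (three_sub_cadences S)"
  proof (rule bij_betw_byWitness[where f' = "\<lambda>(i, d, _). (i - 1, i + 2 * d - 1)"])
    show "\<forall>x\<in>\<Union>a\<in>set S. letter_pairs S a.
        (case (case x of (p, q) \<Rightarrow> (p + 1, (q - p) div 2, 3)) of (i, d, _) \<Rightarrow> (i - 1, i + 2 * d - 1)) = x"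
      by (clarsimp simp: letter_pairs_def)
    show "\<forall>x\<in>three_sub_cadences S.
        (case (case x of (i, d, _) \<Rightarrow> (i - 1, i + 2 * d - 1)) of (p, q) \<Rightarrow> (p + 1, (q - p) div 2, 3)) = x"
      by (auto simp: three_sub_cadences_def three_sub_cadence_def)
    show "(\<lambda>(p, q). (p + 1, (q - p) div 2, 3)) ` (\<Union>a\<in>set S. letter_pairs S a) \<subseteq> three_sub_cadences S"
    proof safe
      fix a p q assume pq: "(p, q) \<in> letter_pairs S a"
      then have "p < q" "even (p + q)"
        unfolding letter_pairs_def by blast+
      then have "q = p + 2 * ((q - p) div 2)" "(q - p) div 2 > 0"
        by presburger+
      then obtain d where d: "q = p + 2 * d" "d > 0" by blast
      then have "(p + q) div 2 = p + d" by simp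
      with pq d show "(p + 1, (q - p) div 2, 3) \<in> three_sub_cadences S"
        by (auto simp: letter_pairs_def three_sub_cadences_def three_sub_cadence_def occurrences_def)
    qed
    show "(\<lambda>(i, d, _). (i - 1, i + 2 * d - 1)) ` three_sub_cadences S \<subseteq> (\<Union>a\<in>set S. letter_pairs S a)"
    proof safe
      fix i d e assume "(i, d, e) \<in> three_sub_cadences S"
      then have i: "0 < i" "0 < d" "i + 2 * d \<le> length S" "S ! (i - 1) = S ! (i + d - 1)"
        "S ! (i + d - 1) = S ! (i + 2 * d - 1)"
        by (auto simp: three_sub_cadences_def three_sub_cadence_def)
      have "i - 1 + (i + 2 * d - 1) = 2 * (i + d - 1)" using i by simp
      then show "(i - 1, i + 2 * d - 1) \<in> (\<Union>a\<in>set S. letter_pairs S a)"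
        using i by (intro UN_I[of "S ! (i - 1)"]) (auto simp: letter_pairs_def occurrences_def)
    qed
  qed
  then have "card (three_sub_cadences S) = card (\<Union>a\<in>set S. letter_pairs S a)"
    by (simp add: bij_betw_same_card)
  also have "\<dots> = (\<Sum>a\<in>set S. card (letter_pairs S a))"
    by (intro card_UN_disjoint ballI impI) (simp, simp, auto simp: letter_pairs_def occurrences_def)
  finally show ?thesis .
qed

lemma card_occurrences_le: "card (occurrences S a) \<le> length S"
  using card_mono[of "{..<length S}" "occurrences S a"] by (auto simp: occurrences_def)

lemma sum_card_occurrences: "(\<Sum>a\<in>set S. card (occurrences S a)) = length S"
proof -
  have "(\<Sum>a\<in>set S. card (occurrences S a)) = card (\<Union>a\<in>set S. occurrences S a)"
    by (intro card_UN_disjoint[symmetric]) (auto simp: occurrences_def)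
  also have "(\<Union>a\<in>set S. occurrences S a) = {..<length S}"
    by (auto simp: occurrences_def)
  finally show ?thesis by simp
qed

text \<open>This quadratic bound keeps the running total of the program within a machine
  word.\<close>

lemma sum_card_letter_pairs_le: "(\<Sum>a\<in>set S. card (letter_pairs S a)) \<le> length S * length S"
proof -
  have "card (letter_pairs S a) \<le> length S * card (occurrences S a)" for a
  proof -
    have "card (letter_pairs S a) \<le> card (occurrences S a \<times> occurrences S a)"
      by (intro card_mono letter_pairs_subset) simp
    also have "\<dots> \<le> length S * card (occurrences S a)"
      using mult_right_mono[OF card_occurrences_le[of S a]] by (simp add: card_cartesian_product)
    finally show ?thesis .
  qed
  then have "(\<Sum>a\<in>set S. card (letter_pairs S a)) \<le> (\<Sum>a\<in>set S. length S * card (occurrences S a))"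
    by (intro sum_mono)
  also have "\<dots> = length S * length S"
    by (simp add: sum_distrib_left[symmetric] sum_card_occurrences)
  finally show ?thesis .
qed

text \<open>This is the shape in which two nested loops over the occurrences accumulate the
  number.\<close>

lemma card_letter_pairs:
  "card (letter_pairs S a) = (\<Sum>p\<in>occurrences S a. \<Sum>q\<in>occurrences S a.
     if p < q \<and> even (p + q) \<and> S ! ((p + q) div 2) = a then 1 else 0)"
proof -
  have "card (letter_pairs S a) = (\<Sum>(p, q)\<in>occurrences S a \<times> occurrences S a.
      if p < q \<and> even (p + q) \<and> S ! ((p + q) div 2) = a then 1 else 0)"
    unfolding letter_pairs_def card_eq_sum
    by (rule sum.mono_neutral_cong_left) (auto split: if_splits)
  then show ?thesis by (simp add: sum.cartesian_product)
qed

section \<open>The convolution of an indicator sequence with itself\<close>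

definition indicator_list :: "'a list \<Rightarrow> 'a \<Rightarrow> int list" where
  "indicator_list S a = map (\<lambda>x. if x = a then 1 else 0) S"

lemma length_indicator_list [simp]: "length (indicator_list S a) = length S"
  by (simp add: indicator_list_def)

text \<open>A product of two indicator values is 1 exactly for two occurrences of \<open>a\<close>
  and 0 otherwise. The hypothesis on \<open>x\<close> makes \<open>2 * x\<close> an index of the
  result, whose length is twice that of \<open>S\<close> minus 1.\<close>

lemma convolution_indicator:
  assumes "x < length S"
  shows "acyclic_convolution (indicator_list S a) (indicator_list S a) ! (2 * x) =
    int (card {(p, q) \<in> occurrences S a \<times> occurrences S a. p + q = 2 * x})"
proof -
  let ?I = "{(j, k). j < length S \<and> k < length S \<and> j + k = 2 * x}"
  have fin: "finite ?I"
    by (rule finite_subset[of _ "{..<length S} \<times> {..<length S}"]) auto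
  have "acyclic_convolution (indicator_list S a) (indicator_list S a) ! (2 * x) =
      (\<Sum>(j, k)\<in>?I. indicator_list S a ! j * indicator_list S a ! k)"
    using assms by (simp add: acyclic_convolution_def)
  also have "\<dots> = (\<Sum>(j, k)\<in>{(p, q) \<in> occurrences S a \<times> occurrences S a. p + q = 2 * x}. 1)"
    by (rule sum.mono_neutral_cong_right[OF fin])
       (auto simp: occurrences_def indicator_list_def split: if_splits)
  finally show ?thesis by simp
qed

definition centered_pairs :: "'a list \<Rightarrow> 'a \<Rightarrow> nat \<Rightarrow> (nat \<times> nat) set" where
  "centered_pairs S a x = {(p, q) \<in> letter_pairs S a. p + q = 2 * x}"

lemma finite_centered_pairs [simp]: "finite (centered_pairs S a x)"
  by (rule finite_subset[OF _ finite_letter_pairs[of S a]]) (auto simp: centered_pairs_def)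

text \<open>With the sum fixed, a pair is determined by its first component. The bound is used to
  show that the convolution entries fit into a word.\<close>

lemma card_centered_pairs_le: "card (centered_pairs S a x) \<le> length S"
proof -
  have "card (centered_pairs S a x) \<le> card (occurrences S a)"
  proof (rule card_inj_on_le[where f = fst])
    show "inj_on fst (centered_pairs S a x)"
      by (rule inj_onI) (auto simp: centered_pairs_def)
    show "fst ` centered_pairs S a x \<subseteq> occurrences S a"
      using letter_pairs_subset by (fastforce simp: centered_pairs_def)
  qed simp
  then show ?thesis using card_occurrences_le[of S a] by linarith
qed

text \<open>Besides \<open>(x, x)\<close>, the pairs with sum \<open>2 * x\<close> come in mirrored couples.\<close>

lemma convolution_indicator_center:
  assumes "x \<in> occurrences S a"
  shows "acyclic_convolution (indicator_list S a) (indicator_list S a) ! (2 * x) =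
    1 + 2 * int (card (centered_pairs S a x))"
proof -
  let ?P = "centered_pairs S a x"
  let ?P' = "prod.swap ` ?P"
  have x: "x < length S" "S ! x = a" using assms by (auto simp: occurrences_def)
  have fin: "finite ?P" by simp
  have "{(p, q) \<in> occurrences S a \<times> occurrences S a. p + q = 2 * x} = insert (x, x) (?P \<union> ?P')"
  proof (intro equalityI subsetI)
    fix z assume "z \<in> {(p, q) \<in> occurrences S a \<times> occurrences S a. p + q = 2 * x}"
    then obtain p q where z: "z = (p, q)" "p \<in> occurrences S a" "q \<in> occurrences S a" "p + q = 2 * x"
      by auto
    have ev: "even p \<longleftrightarrow> even q" using z(4) by presburger
    consider "p = q" | "p < q" | "q < p" by linarith
    then show "z \<in> insert (x, x) (?P \<union> ?P')"
    proof cases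
      case 2
      then show ?thesis using z x ev by (auto simp: letter_pairs_def centered_pairs_def)
    next
      case 3
      then have "(q, p) \<in> ?P" using z x ev by (auto simp: letter_pairs_def centered_pairs_def add.commute)
      then have "prod.swap (q, p) \<in> ?P'" by (rule imageI)
      then show ?thesis using z by simp
    qed (use z in auto)
  qed (use assms in \<open>auto simp: letter_pairs_def centered_pairs_def\<close>)
  moreover have "card (insert (x, x) (?P \<union> ?P')) = Suc (card (?P \<union> ?P'))"
    by (rule card_insert_disjoint) (use fin in \<open>auto simp: letter_pairs_def centered_pairs_def\<close>)
  moreover have "card (?P \<union> ?P') = card ?P + card ?P'"
    by (rule card_Un_disjoint) (use fin in \<open>auto simp: letter_pairs_def centered_pairs_def\<close>)
  moreover have "card ?P' = card ?P"
    by (rule card_image) (auto intro: inj_onI)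
  ultimately show ?thesis
    using convolution_indicator[OF x(1), of a] by simp
qed

text \<open>Each pair is counted at exactly one centre, its midpoint, which is itself an occurrence
  by the definition of \<open>letter_pairs\<close>.\<close>

lemma sum_centered_pairs:
  "(\<Sum>x\<in>occurrences S a. card (centered_pairs S a x)) = card (letter_pairs S a)"
proof -
  have "(\<Union>x\<in>occurrences S a. centered_pairs S a x) = letter_pairs S a"
  proof (intro equalityI subsetI)
    fix z assume z: "z \<in> letter_pairs S a"
    then obtain p q where pq: "z = (p, q)" "p < q" "even (p + q)" "q < length S" "S ! ((p + q) div 2) = a"
      by (auto simp: letter_pairs_def occurrences_def)
    from pq(2-4) have "(p + q) div 2 < length S" "p + q = 2 * ((p + q) div 2)" by simp_all
    with z pq show "z \<in> (\<Union>x\<in>occurrences S a. centered_pairs S a x)"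
      by (intro UN_I[of "(p + q) div 2"]) (auto simp: occurrences_def centered_pairs_def)
  qed (auto simp: centered_pairs_def)
  moreover have "card (\<Union>x\<in>occurrences S a. centered_pairs S a x) =
      (\<Sum>x\<in>occurrences S a. card (centered_pairs S a x))"
    by (intro card_UN_disjoint ballI impI) (simp, simp, auto simp: centered_pairs_def)
  ultimately show ?thesis by simp
qed

text \<open>\<open>X\<close> sorts the keys \<open>S[x] * n + x\<close>, so that \<open>div\<close> recovers the letter and \<open>mod\<close> the position.\<close>

definition sorted_keys :: "int list \<Rightarrow> (nat \<Rightarrow> int) \<Rightarrow> bool" where
  "sorted_keys S X \<longleftrightarrow> strict_mono_on {..<length S} X \<and>
     X ` {..<length S} = (\<lambda>x. S ! x * int (length S) + int x) ` {..<length S}"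

text \<open>Negative letters are covered too, since \<open>div\<close> rounds towards minus
  infinity.\<close>

lemma key_div [simp]:
  assumes "x < n"
  shows "(y * int n + int x) div int n = y"
proof -
  have "int n \<noteq> 0" using assms by simp
  then show ?thesis using assms by simp
qed

lemma sorted_keys_div_mod:
  assumes "sorted_keys S X" "i < length S"
  shows "X i mod int (length S) = int (nat (X i mod int (length S)))"
    and "nat (X i mod int (length S)) < length S"
    and "X i div int (length S) = S ! nat (X i mod int (length S))"
proof -
  have "X i \<in> X ` {..<length S}" using assms(2) by simp
  then obtain x where x: "x < length S" "X i = S ! x * int (length S) + int x"
    using assms(1) unfolding sorted_keys_def by auto
  moreover have "S \<noteq> []" using assms(2) by auto
  ultimately show "X i mod int (length S) = int (nat (X i mod int (length S)))"
    "nat (X i mod int (length S)) < length S"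
    "X i div int (length S) = S ! nat (X i mod int (length S))"
    by simp_all
qed

lemma sorted_keys_div_mono:
  assumes "sorted_keys S X" "i \<le> j" "j < length S"
  shows "X i div int (length S) \<le> X j div int (length S)"
proof -
  have "X i \<le> X j"
    using assms strict_mono_onD[of "{..<length S}" X i j] by (cases "i = j") (auto simp: sorted_keys_def)
  then show ?thesis using assms by (intro zdiv_mono1) auto
qed

lemma sorted_keys_set:
  assumes "sorted_keys S X"
  shows "(\<lambda>i. X i div int (length S)) ` {..<length S} = set S"
proof -
  have "(\<lambda>i. X i div int (length S)) ` {..<length S} = (\<lambda>y. y div int (length S)) ` X ` {..<length S}"
    by (simp add: image_image)
  also have "X ` {..<length S} = (\<lambda>x. S ! x * int (length S) + int x) ` {..<length S}"
    using assms by (simp add: sorted_keys_def)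
  also have "(\<lambda>y. y div int (length S)) ` \<dots> = (!) S ` {..<length S}"
    by (auto simp: image_image intro!: image_cong)
  finally show ?thesis by (auto simp: set_conv_nth)
qed

text \<open>A key is determined by its quotient and its remainder modulo the length. In a group the
  quotient is constant and the keys are distinct, so the remainders, which are positions, are
  distinct as well. Through this bijection loops over sorted indices become sums over the
  occurrences of a letter.\<close>

lemma bij_betw_group:
  assumes X: "sorted_keys S X" and hi: "hi \<le> length S"
    and a: "\<And>i. i < length S \<Longrightarrow> X i div int (length S) = a \<longleftrightarrow> lo \<le> i \<and> i < hi"
  shows "bij_betw (\<lambda>i. nat (X i mod int (length S))) {lo..<hi} (occurrences S a)"
proof (rule bij_betw_imageI)
  let ?g = "\<lambda>i. nat (X i mod int (length S))"
  note dm = sorted_keys_div_mod[OF X]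
  show "inj_on ?g {lo..<hi}"
  proof (rule inj_onI)
    fix i j assume ij: "i \<in> {lo..<hi}" "j \<in> {lo..<hi}" "?g i = ?g j"
    have ln: "i < length S" "j < length S" using ij hi by auto
    have "X i mod int (length S) = X j mod int (length S)"
      using ij(3) dm(1)[OF ln(1)] dm(1)[OF ln(2)] by metis
    moreover have "X i div int (length S) = X j div int (length S)"
      using a[OF ln(1)] a[OF ln(2)] ij by simp
    ultimately have "X i = X j" by (metis div_mult_mod_eq)
    then show "i = j"
      using X ln by (auto simp: sorted_keys_def dest: strict_mono_on_imp_inj_on inj_onD)
  qed
  show "?g ` {lo..<hi} = occurrences S a"
  proof (intro equalityI subsetI)
    fix x assume x: "x \<in> occurrences S a"
    then have "S ! x * int (length S) + int x \<in> X ` {..<length S}"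
      using X by (auto simp: sorted_keys_def occurrences_def)
    then obtain i where i: "i < length S" "X i = S ! x * int (length S) + int x" by auto
    then have "X i div int (length S) = a" "?g i = x"
      using x by (auto simp: occurrences_def)
    then show "x \<in> ?g ` {lo..<hi}" using a[OF i(1)] by force
  next
    fix x assume "x \<in> ?g ` {lo..<hi}"
    then obtain i where i: "i \<in> {lo..<hi}" "x = ?g i" by blast
    then have "i < length S" using hi by simp
    then show "x \<in> occurrences S a"
      using dm(2,3)[OF \<open>i < length S\<close>] a[OF \<open>i < length S\<close>] i by (auto simp: occurrences_def)
  qed
qed

section \<open>The counting program\<close>

lemma sum_indicator_le:
  "(\<Sum>i\<in>A. \<Sum>j\<in>B. if P i j then 1 else 0) \<le> card A * card B"
proof -
  have "(\<Sum>i\<in>A. \<Sum>j\<in>B. if P i j then 1 else 0) \<le> (\<Sum>i\<in>A. card B)"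
    by (intro sum_mono order_trans[OF sum_bounded_above[where K = 1]]) auto
  then show ?thesis by simp
qed

context fresh_names
begin

definition position :: "register \<Rightarrow> aexp" where
  "position i = Bin Mod (R Keys (V i)) (V Len)"

text \<open>Both loops run over the whole group, and \<open>Less\<close> selects one of the two
  orders. The character in the middle is read even if the sum of the positions is odd; this is safe
  because the rounded midpoint of two positions is again a position.\<close>

definition count_pairs :: com where
  "count_pairs =
     For (v Idx) (V GroupStart) (v GroupEnd) (For (v Idx2) (V GroupStart) (v GroupEnd)
       (Seq (Assign (v LeftPos) (position Idx))
       (Seq (Assign (v RightPos) (position Idx2))
            (If (And (Less (V LeftPos) (V RightPos))
                (And (Eq (Bin Mod (Bin Add (V LeftPos) (V RightPos)) (Const 2)) (Const 0))
                     (Eq (R Chars (Bin Div (Bin Add (V LeftPos) (V RightPos)) (Const 2))) (V Letter))))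
              (Assign (v Total) (Bin Add (V Total) (Const 1)))
              Skip))))"

text \<open>An entry of the convolution at twice an occurrence is one plus twice the number of
  sub-cadences centred there; subtracting 1 and halving inverts this. Both input arrays are cleared
  first, as they may hold anything, including remains of the previous letter.\<close>

definition count_by_convolution :: com where
  "count_by_convolution =
     Seq (Assign ''m'' (V Len))
    (Seq (For (v Idx) (Const 0) (v Len)
           (Seq (Store ''a'' (V Idx) (Const 0)) (Store ''b'' (V Idx) (Const 0))))
    (Seq (For (v Idx) (V GroupStart) (v GroupEnd)
           (Seq (Store ''a'' (position Idx) (Const 1)) (Store ''b'' (position Idx) (Const 1))))
    (Seq conv
         (For (v Idx) (V GroupStart) (v GroupEnd)
           (Assign (v Total) (Bin Add (V Total)
             (Bin Div (Bin Sub (Read ''c'' (Bin Mul (Const 2) (position Idx))) (Const 1)) (Const 2))))))))"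

definition find_group :: com where
  "find_group =
     Seq (Assign (v Letter) (Bin Div (R Keys (V GroupStart)) (V Len)))
    (Seq (Assign (v GroupEnd) (Bin Add (V GroupStart) (Const 1)))
         (While (And (Less (V GroupEnd) (V Len)) (Eq (Bin Div (R Keys (V GroupEnd)) (V Len)) (V Letter)))
           (Assign (v GroupEnd) (Bin Add (V GroupEnd) (Const 1)))))"

definition group_size :: aexp where
  "group_size = Bin Sub (V GroupEnd) (V GroupStart)"

definition count_group :: com where
  "count_group = If (Less (Bin Mul (V Len) (V Rounds)) (Bin Mul group_size group_size))
     count_by_convolution count_pairs"

definition count_all :: com where
  "count_all =
     Seq (Assign (v GroupStart) (Const 0))
    (Seq (Assign (v Total) (Const 0))
         (While (Less (V GroupStart) (V Len))
           (Seq find_group (Seq count_group (Assign (v GroupStart) (V GroupEnd))))))"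

definition group_state :: "int list \<Rightarrow> (nat \<Rightarrow> int) \<Rightarrow> nat \<Rightarrow> nat \<Rightarrow> int \<Rightarrow> state \<Rightarrow> bool" where
  "group_state S X lo hi a s \<longleftrightarrow> var s (v Len) = int (length S) \<and> var s (v Letter) = a \<and>
     var s (v GroupStart) = int lo \<and> var s (v GroupEnd) = int hi \<and> arr s (v Keys) = X \<and>
     array_holds s (v Chars) S"

lemma wp_count_pairs:
  fixes S :: "int list" and X :: "nat \<Rightarrow> int" and T :: nat
  defines "n \<equiv> length S" and "g \<equiv> (\<lambda>i. nat (X i mod int (length S)))"
  assumes st: "group_state S X lo hi a s" and T: "var s (v Total) = int T" "T \<le> n * n"
    and X: "sorted_keys S X" and W: "3 * (int n * int n) + 4 * int n + 8 \<le> W"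
    and hi: "lo < hi" "hi \<le> n" and bd: "\<And>i. i \<le> n \<Longrightarrow> \<bar>X i\<bar> \<le> W" "\<And>x. x \<in> set S \<Longrightarrow> \<bar>x\<bar> \<le> W"
    and a: "\<bar>a\<bar> \<le> W"
    and bij: "bij_betw g {lo..<hi} (occurrences S a)"
    and Q: "\<And>s' t'. frame count_pairs s s' \<Longrightarrow> t' \<le> t + 100 * ((hi - lo) * (hi - lo)) \<Longrightarrow>
      var s' (v Total) = int (T + card (letter_pairs S a)) \<Longrightarrow> Q s' t'"
  shows "wp W count_pairs Q s t"
proof -
  define f where "f = hi - lo"
  define ind :: "nat \<Rightarrow> nat \<Rightarrow> nat" where
    "ind = (\<lambda>i j. if g i < g j \<and> even (g i + g j) \<and> S ! ((g i + g j) div 2) = a then 1 else 0)"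
  define I where "I = (\<lambda>k (s' :: state) t'. t' \<le> t + 10 + (60 * f + 15) * (k - lo) \<and>
    var s' (v Total) = int (T + (\<Sum>i\<in>{lo..<k}. \<Sum>j\<in>{lo..<hi}. ind i j)))"
  \<comment> \<open>\<open>J\<close> starts 6 operations above \<open>I\<close>: 4 for the test of
    the outer loop and 2 for setting the inner counter. The 15 per outer step pays for this and for
    the end of the inner loop.\<close>
  define J where "J = (\<lambda>i k (s' :: state) t'. t' \<le> t + 16 + (60 * f + 15) * (i - lo) + 60 * (k - lo) \<and>
    var s' (v Total) = int (T + (\<Sum>i\<in>{lo..<i}. \<Sum>j\<in>{lo..<hi}. ind i j) + (\<Sum>j\<in>{lo..<k}. ind i j)))"
  have nW: "int n \<le> W" "8 \<le> W" using W zero_le_mult_iff[of "int n" "int n"] by linarith+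
  \<comment> \<open>The total is at most \<open>n * n\<close> from earlier letters,
    \<open>n * n\<close> from finished rows and \<open>n\<close> from the current row. The quadratic
    term in the hypothesis on \<open>W\<close> leaves room for this.\<close>
  have le_W: "int T + int (\<Sum>i\<in>{lo..<i}. \<Sum>j\<in>{lo..<hi}. ind i j) + int (\<Sum>j\<in>{lo..<k}. ind i j) + 1 \<le> W"
    if "i < hi" "k < hi" for i k
  proof -
    have "(\<Sum>i\<in>{lo..<i}. \<Sum>j\<in>{lo..<hi}. ind i j) \<le> card {lo..<i} * card {lo..<hi}"
      unfolding ind_def by (rule sum_indicator_le)
    also have "\<dots> \<le> n * n" using hi that by (intro mult_le_mono) auto
    finally have 1: "(\<Sum>i\<in>{lo..<i}. \<Sum>j\<in>{lo..<hi}. ind i j) \<le> n * n" .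
    have "(\<Sum>j\<in>{lo..<k}. ind i j) \<le> of_nat (card {lo..<k}) * 1"
      by (rule sum_bounded_above) (auto simp: ind_def)
    also have "\<dots> \<le> n" using hi that by auto
    finally have 2: "(\<Sum>j\<in>{lo..<k}. ind i j) \<le> n" by simp
    have "T + (\<Sum>i\<in>{lo..<i}. \<Sum>j\<in>{lo..<hi}. ind i j) + (\<Sum>j\<in>{lo..<k}. ind i j) + 1 \<le> 2 * (n * n) + n + 1"
      using 1 2 T by linarith
    then have "int (T + (\<Sum>i\<in>{lo..<i}. \<Sum>j\<in>{lo..<hi}. ind i j) + (\<Sum>j\<in>{lo..<k}. ind i j) + 1) \<le> int (2 * (n * n) + n + 1)"
      by (rule of_nat_mono)
    then have "int T + int (\<Sum>i\<in>{lo..<i}. \<Sum>j\<in>{lo..<hi}. ind i j) + int (\<Sum>j\<in>{lo..<k}. ind i j) + 1 \<le>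
        2 * (int n * int n) + int n + 1" by simp
    then show ?thesis using W zero_le_mult_iff[of "int n" "int n"] by linarith
  qed
  have dm: "X i mod int n = int (g i)" "g i < n" if "i < n" for i
    using sorted_keys_div_mod[OF X, of i] that by (auto simp: n_def g_def)
  have body: "wp W (Seq (Assign (v LeftPos) (position Idx))
       (Seq (Assign (v RightPos) (position Idx2))
            (If (And (Less (V LeftPos) (V RightPos))
                (And (Eq (Bin Mod (Bin Add (V LeftPos) (V RightPos)) (Const 2)) (Const 0))
                     (Eq (R Chars (Bin Div (Bin Add (V LeftPos) (V RightPos)) (Const 2))) (V Letter))))
              (Assign (v Total) (Bin Add (V Total) (Const 1)))
              Skip))) (\<lambda>s' t'. J i (Suc k) (s'\<lparr>var := (var s')(v Idx2 := int k + 1)\<rparr>) (t' + 4)) s1 (t1 + 4)"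
    if "J i k s1 t1" "lo \<le> i" "i < hi" "lo \<le> k" "k < hi" "var s1 (v Idx) = int i" "var s1 (v Idx2) = int k"
      "arr s1 (v Keys) = X" "array_holds s1 (v Chars) S" "var s1 (v Letter) = a" "var s1 (v Len) = int n" for i k s1 t1
  proof -
    have ik: "i < n" "k < n" using that hi by auto
    note dmi = dm[OF ik(1)] and dmk = dm[OF ik(2)]
    define c where "c = (g i + g k) div 2"
    have c: "(int (g i) + int (g k)) div 2 = int c" "c < n"
      using dmi dmk by (auto simp: c_def)
    have ch: "arr s1 (v Chars) c = S ! c" using that(9) c(2) by (simp add: array_holds_def n_def)
    have cW: "\<bar>S ! c\<bar> \<le> W" using c(2) bd(2) by (simp add: n_def)
    have ev: "(int (g i) + int (g k)) mod 2 = 0 \<longleftrightarrow> even (g i + g k)"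
      by presburger
    have t1: "t1 \<le> t + 16 + (60 * f + 15) * (i - lo) + 60 * (k - lo)"
      and tot': "var s1 (v Total) = int (T + (\<Sum>i\<in>{lo..<i}. \<Sum>j\<in>{lo..<hi}. ind i j) + (\<Sum>j\<in>{lo..<k}. ind i j))"
      using that(1) by (auto simp: J_def)
    obtain u where u: "u = T + (\<Sum>i\<in>{lo..<i}. \<Sum>j\<in>{lo..<hi}. ind i j) + (\<Sum>j\<in>{lo..<k}. ind i j)"
      by blast
    have tot: "var s1 (v Total) = int u" and lw: "int u + 1 \<le> W"
      using le_W[OF \<open>i < hi\<close> \<open>k < hi\<close>] tot' by (simp_all add: u)
    have Jn: "J i (Suc k) s2 t2" if "t2 \<le> t1 + 60" "var s2 (v Total) = var s1 (v Total) + int (ind i k)" for s2 t2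
      using that t1 tot' \<open>lo \<le> k\<close> unfolding J_def by (auto simp: Suc_diff_le)
    have sums: "int (g i) + int (g k) \<le> W" "int (g i) \<le> W" "int (g k) \<le> W" "int c \<le> W"
      using dmi dmk c W zero_le_mult_iff[of "int n" "int n"] by linarith+
    show ?thesis
      unfolding position_def
      by (intro wp_Seq wp_Assign wp_If wp_Skip Jn)
        (use that sums bd ik cW a ch tot lw nW in \<open>auto simp: dmi dmk c ch ev ind_def c_def[symmetric]\<close>)
  qed
  have outer: "wp W (For (v Idx2) (V GroupStart) (v GroupEnd)
       (Seq (Assign (v LeftPos) (position Idx))
       (Seq (Assign (v RightPos) (position Idx2))
            (If (And (Less (V LeftPos) (V RightPos))
                (And (Eq (Bin Mod (Bin Add (V LeftPos) (V RightPos)) (Const 2)) (Const 0))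
                     (Eq (R Chars (Bin Div (Bin Add (V LeftPos) (V RightPos)) (Const 2))) (V Letter))))
              (Assign (v Total) (Bin Add (V Total) (Const 1)))
              Skip)))) (\<lambda>s' t'. I (Suc i) (s'\<lparr>var := (var s')(v Idx := int i + 1)\<rparr>) (t' + 4)) s1 (t1 + 4)"
    if "I i s1 t1" "lo \<le> i" "i < hi" "var s1 (v Idx) = int i" "group_state S X lo hi a s1" for i s1 t1
  proof (intro wp_For[where I = "J i" and a = lo and b = hi] body, goal_cases)
    show "I (Suc i) (s'\<lparr>var := (var s')(v Idx := int i + 1)\<rparr>) (t' + 4 + 4)" if "J i hi s' t'" for s' t'
      using that \<open>lo \<le> i\<close> hi unfolding I_def J_def by (auto simp: f_def Suc_diff_le add_mult_distrib2)
  qed (use that hi nW st in \<open>auto simp: I_def J_def group_state_def frame_def n_def array_holds_def\<close>)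
  have "wp W count_pairs (\<lambda>s' t'. I hi s' (t' - 4) \<and> 4 \<le> t') s t"
    unfolding count_pairs_def
    by (intro wp_For[where I = I and a = lo and b = hi] outer)
      (use st hi nW T in \<open>auto simp: group_state_def I_def frame_def array_holds_def\<close>)
  moreover have "(\<Sum>i\<in>{lo..<hi}. \<Sum>j\<in>{lo..<hi}. ind i j) = card (letter_pairs S a)"
    unfolding card_letter_pairs ind_def by (simp add: sum.reindex_bij_betw[OF bij, symmetric])
  \<comment> \<open>The group is not empty, so \<open>f \<ge> 1\<close> and the linear and constant
    terms are absorbed by \<open>f * f\<close>.\<close>
  moreover have "10 + (60 * f + 15) * f + 4 \<le> 100 * (f * f)"
  proof -
    have "f \<le> f * f" "1 \<le> f" using hi by (auto simp: f_def)
    then show ?thesis unfolding add_mult_distrib by linarith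
  qed
  ultimately show ?thesis
    by (elim wp_mono) (rule Q, auto simp: I_def f_def simp del: of_nat_sum)
qed

end

text \<open>For negative \<open>x\<close> the quotient is rounded away from zero, but
  \<open>x * k \<le> x\<close> still keeps it between \<open>x\<close> and 0. This bounds the
  letters recovered from the keys.\<close>

lemma abs_div_le:
  fixes x k :: int
  assumes "1 \<le> k"
  shows "\<bar>x div k\<bar> \<le> \<bar>x\<bar>"
proof (cases "0 \<le> x")
  case True
  then show ?thesis using assms zdiv_mono2[of x 1 k] by (simp add: pos_imp_zdiv_nonneg_iff)
next
  case False
  then have "x * k \<le> x * 1" using assms by (intro mult_left_mono_neg) auto
  then have "x * k div k \<le> x div k" using assms by (intro zdiv_mono1) auto
  moreover have "x div k < 0" using False assms by (simp add: pos_imp_zdiv_neg_iff)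
  ultimately show ?thesis using assms by simp
qed

section \<open>Counting for one letter, then for all letters\<close>

context fresh_names
begin

lemma wp_count_by_convolution:
  fixes S :: "int list" and X :: "nat \<Rightarrow> int" and T D kc :: nat
  defines "n \<equiv> length S" and "g \<equiv> (\<lambda>i. nat (X i mod int (length S)))"
  assumes st: "group_state S X lo hi a s" and T: "var s (v Total) = int T" "T \<le> n * n"
    and X: "sorted_keys S X" and W: "3 * (int n * int n) + 4 * int n + 8 \<le> W"
    and hi: "lo < hi" "hi \<le> n" and bd: "\<And>i. i \<le> n \<Longrightarrow> \<bar>X i\<bar> \<le> W"
    and bij: "bij_betw g {lo..<hi} (occurrences S a)"
    and conv: "convolves_within conv kc (real D) (indicator_list S a) (indicator_list S a)" "word_bound kc n \<le> W"
    and Q: "\<And>s' t'. frame count_by_convolution s s' \<Longrightarrow> t' \<le> t + 110 * n + D \<Longrightarrow>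
      var s' (v Total) = int (T + card (letter_pairs S a)) \<Longrightarrow> Q s' t'"
  shows "wp W count_by_convolution Q s t"
proof -
  \<comment> \<open>\<open>h i\<close> is the contribution of the \<open>i\<close>-th sorted key:
    the number of sub-cadences whose middle is the position stored in it.\<close>
  define h where "h = (\<lambda>i. card (centered_pairs S a (g i)))"
  have nW: "int n \<le> W" "8 \<le> W" "2 * int n + 1 \<le> W" using W zero_le_mult_iff[of "int n" "int n"] by linarith+
  have dm: "X i mod int n = int (g i)" "g i < n" if "i < n" for i
    using sorted_keys_div_mod[OF X, of i] that by (auto simp: n_def g_def)
  have gW: "int (g j) \<le> W" "2 * int (g j) \<le> W" if "j < hi" for j
    using dm(2)[of j] that hi nW by linarith+
  define I1 where "I1 = (\<lambda>k (s' :: state) t'. t' \<le> t + 5 + 16 * k \<and>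
    (\<forall>x<k. arr s' ''a'' x = 0 \<and> arr s' ''b'' x = 0))"
  define I2 where "I2 = (\<lambda>k (s' :: state) t'. t' \<le> t + 12 + 16 * n + 24 * (k - lo) \<and>
    (\<forall>x<n. arr s' ''a'' x = (if x \<in> g ` {lo..<k} then 1 else 0) \<and>
           arr s' ''b'' x = (if x \<in> g ` {lo..<k} then 1 else 0)))"
  define I3 where "I3 = (\<lambda>k (s' :: state) t'. t' \<le> t + 30 + 40 * n + D + 30 * (k - lo) \<and>
    var s' (v Total) = int (T + (\<Sum>i\<in>{lo..<k}. h i)))"
  define C where "C = acyclic_convolution (indicator_list S a) (indicator_list S a)"
  have lenC: "length C = n + n - 1" by (simp add: C_def acyclic_convolution_def n_def)
  have hn: "h i \<le> n" for i
    unfolding h_def n_def by (rule card_centered_pairs_le)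
  have Cg: "C ! (2 * g i) = 1 + 2 * int (h i)" if "lo \<le> i" "i < hi" for i
  proof -
    have "g i \<in> occurrences S a" using bij that by (auto simp: bij_betw_def)
    then show ?thesis unfolding C_def h_def by (rule convolution_indicator_center)
  qed
  have sum_h: "(\<Sum>i\<in>{lo..<hi}. h i) = card (letter_pairs S a)"
    unfolding h_def sum_centered_pairs[symmetric] by (rule sum.reindex_bij_betw[OF bij])
  have le_W: "int (T + (\<Sum>i\<in>{lo..<k}. h i)) + int (h k) \<le> W" if "k < hi" for k
  proof -
    have "(\<Sum>i\<in>{lo..<k}. h i) \<le> of_nat (card {lo..<k}) * n"
      by (rule sum_bounded_above) (rule hn)
    also have "\<dots> \<le> n * n" using hi that by (intro mult_le_mono) auto
    finally have "T + (\<Sum>i\<in>{lo..<k}. h i) + h k \<le> 2 * (n * n) + n"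
      using T hn[of k] by linarith
    then have "int (T + (\<Sum>i\<in>{lo..<k}. h i) + h k) \<le> int (2 * (n * n) + n)"
      by (rule of_nat_mono)
    then have "int (T + (\<Sum>i\<in>{lo..<k}. h i)) + int (h k) \<le> 2 * (int n * int n) + int n" by simp
    then show ?thesis using W zero_le_mult_iff[of "int n" "int n"] by linarith
  qed
  have clear: "wp W (For (v Idx) (Const 0) (v Len)
           (Seq (Store ''a'' (V Idx) (Const 0)) (Store ''b'' (V Idx) (Const 0)))) Q' s1 t1"
    if "t1 \<le> t + 3" "var s1 (v Len) = int n" "\<And>s' t'. I1 n s' t' \<Longrightarrow> frame (For (v Idx) (Const 0) (v Len)
           (Seq (Store ''a'' (V Idx) (Const 0)) (Store ''b'' (V Idx) (Const 0)))) s1 s' \<Longrightarrow> Q' s' (t' + 4)" for Q' s1 t1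
    by (intro wp_For[where I = I1 and a = 0 and b = n] wp_Seq wp_Store)
      (use that nW in \<open>auto simp: I1_def less_Suc_eq frame_def\<close>)
  have set: "wp W (For (v Idx) (V GroupStart) (v GroupEnd)
           (Seq (Store ''a'' (position Idx) (Const 1)) (Store ''b'' (position Idx) (Const 1)))) Q' s1 t1"
    if "I1 n s1 (t1 - 4)" "4 \<le> t1" "group_state S X lo hi a s1" "\<And>s' t'. I2 hi s' t' \<Longrightarrow> frame (For (v Idx) (V GroupStart) (v GroupEnd)
           (Seq (Store ''a'' (position Idx) (Const 1)) (Store ''b'' (position Idx) (Const 1)))) s1 s' \<Longrightarrow> Q' s' (t' + 4)" for Q' s1 t1
    unfolding position_def
    by (intro wp_For[where I = I2 and a = lo and b = hi] wp_Seq wp_Store)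
      (use that hi nW bd gW in \<open>auto simp: I1_def I2_def frame_def group_state_def dm
          n_def[symmetric] Suc_diff_le atLeastLessThanSuc\<close>)
  have use_conv: "wp W conv Q' s1 t1"
    if "I2 hi s1 (t1 - 4)" "4 \<le> t1" "group_state S X lo hi a s1" "var s1 ''m'' = int n"
      "\<And>s' t'. array_holds s' ''c'' C \<Longrightarrow> t' \<le> t1 + D \<Longrightarrow> frame conv s1 s' \<Longrightarrow> Q' s' t'" for Q' s1 t1
  proof -
    note m = that(4)
    have "array_holds s1 ''a'' (indicator_list S a)" "array_holds s1 ''b'' (indicator_list S a)"
      using that(1) bij by (auto simp: I2_def array_holds_def indicator_list_def n_def bij_betw_def occurrences_def)
    then obtain u s' where u: "exec (word_bound kc n) conv s1 u s'" "real u \<le> real D" "array_holds s' ''c'' C"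
      using conv(1) m unfolding convolves_within_def C_def by (auto simp: n_def)
    \<comment> \<open>The convolution program is only known to run under its own word bound;
      enlarging the bound keeps its derivation and its time.\<close>
    have "wp W conv (\<lambda>s' t'. array_holds s' ''c'' C \<and> t' \<le> t1 + D) s1 t1"
      unfolding wp_def using exec_mono[OF u(1) conv(2)] u(2,3) by auto
    then show ?thesis by (rule wp_mono) (use that(5) in auto)
  qed
  have accumulate: "wp W (For (v Idx) (V GroupStart) (v GroupEnd)
           (Assign (v Total) (Bin Add (V Total)
             (Bin Div (Bin Sub (Read ''c'' (Bin Mul (Const 2) (position Idx))) (Const 1)) (Const 2))))) Q' s1 t1"
    if "array_holds s1 ''c'' C" "t1 \<le> t + 20 + 40 * n + D" "group_state S X lo hi a s1"
      "var s1 (v Total) = int T" "\<And>s' t'. I3 hi s' t' \<Longrightarrow> Q' s' (t' + 4)" for Q' s1 t1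
  proof -
    have c: "arr s' ''c'' (2 * g j) = 1 + 2 * int (h j)" if "arr s' ''c'' = arr s1 ''c''" "lo \<le> j" "j < hi" for s' j
      using that Cg[of j] dm(2)[of j] hi \<open>array_holds s1 ''c'' C\<close> lenC by (auto simp: array_holds_def)
    have step: "wp W (Assign (v Total) (Bin Add (V Total)
             (Bin Div (Bin Sub (Read ''c'' (Bin Mul (Const 2) (position Idx))) (Const 1)) (Const 2))))
          (\<lambda>s' t'. I3 (Suc j) (s'\<lparr>var := (var s')(v Idx := int j + 1)\<rparr>) (t' + 4)) s2 (t2 + 4)"
      if "I3 j s2 t2" "lo \<le> j" "j < hi" "var s2 (v Idx) = int j" "var s2 (v Len) = int n"
        "arr s2 (v Keys) = X" "arr s2 ''c'' = arr s1 ''c''" for j s2 t2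
    proof -
      have jn: "j < n" using that hi by simp
      obtain u where u: "u = T + (\<Sum>i\<in>{lo..<j}. h i)" by blast
      have tot: "var s2 (v Total) = int u" using that(1) by (simp add: I3_def u)
      have uW: "int u + int (h j) \<le> W" using le_W[OF \<open>j < hi\<close>] by (simp add: u)
      have I3n: "I3 (Suc j) s3 t3" if "t3 \<le> t2 + 30" "var s3 (v Total) = int u + int (h j)" for s3 t3
        using that \<open>I3 j s2 t2\<close> \<open>lo \<le> j\<close> by (auto simp: I3_def u Suc_diff_le)
      have hW: "int (h j) \<le> W" "1 + 2 * int (h j) \<le> W" using hn[of j] nW by linarith+
      show ?thesis
        unfolding position_def
        by (intro wp_Assign I3n)
          (use that c[OF that(7,2,3)] tot uW hW nW gW bd[of j] jn in \<open>auto simp: dm nat_mult_distrib\<close>)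
    qed
    show ?thesis
      by (intro wp_For[where I = I3 and a = lo and b = hi] step)
        (use that hi nW in \<open>auto simp: I3_def frame_def group_state_def n_def[symmetric]\<close>)
  qed
  have st_cong: "group_state S X lo hi a s2"
    if "frame p s1 s2" "group_state S X lo hi a s1"
      "{v Len, v Letter, v GroupStart, v GroupEnd} \<inter> written_vars p = {}"
      "{v Keys, v Chars} \<inter> written_arrs p = {}" for p s1 s2
    using that by (simp add: group_state_def frame_def array_holds_def)
  have "wp W count_by_convolution (\<lambda>s' t'. I3 hi s' (t' - 4) \<and> 4 \<le> t') s t"
    unfolding count_by_convolution_def
  proof (intro wp_Seq wp_Assign, goal_cases)
    case 1
    then show ?case using st nW by (simp add: group_state_def n_def[symmetric])
  next
    case 2
    let ?s1 = "s\<lparr>var := (var s)(''m'' := aval (V Len) s)\<rparr>"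
    have st1: "group_state S X lo hi a ?s1" "var ?s1 ''m'' = int n" "var ?s1 (v Total) = int T"
      using st T by (simp_all add: group_state_def n_def array_holds_def)
    show ?case
    proof (rule clear)
      fix s2 t2 assume 2: "I1 n s2 t2" "frame (For (v Idx) (Const 0) (v Len)
           (Seq (Store ''a'' (V Idx) (Const 0)) (Store ''b'' (V Idx) (Const 0)))) ?s1 s2"
      have st2: "group_state S X lo hi a s2" "var s2 ''m'' = int n" "var s2 (v Total) = int T"
        using st_cong[OF 2(2) st1(1)] frame_var[OF 2(2), of "''m''"] frame_var[OF 2(2), of "v Total"] st1
        by simp_all
      show "wp W (Seq (For (v Idx) (V GroupStart) (v GroupEnd)
           (Seq (Store ''a'' (position Idx) (Const 1)) (Store ''b'' (position Idx) (Const 1))))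
         (Seq conv (For (v Idx) (V GroupStart) (v GroupEnd)
           (Assign (v Total) (Bin Add (V Total)
             (Bin Div (Bin Sub (Read ''c'' (Bin Mul (Const 2) (position Idx))) (Const 1)) (Const 2)))))))
         (\<lambda>s' t'. I3 hi s' (t' - 4) \<and> 4 \<le> t') s2 (t2 + 4)"
      proof (rule wp_Seq, rule set)
        fix s3 t3 assume 3: "I2 hi s3 t3" "frame (For (v Idx) (V GroupStart) (v GroupEnd)
           (Seq (Store ''a'' (position Idx) (Const 1)) (Store ''b'' (position Idx) (Const 1)))) s2 s3"
        have st3: "group_state S X lo hi a s3" "var s3 ''m'' = int n" "var s3 (v Total) = int T"
          using st_cong[OF 3(2) st2(1)] frame_var[OF 3(2), of "''m''"] frame_var[OF 3(2), of "v Total"] st2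
          by simp_all
        show "wp W (Seq conv (For (v Idx) (V GroupStart) (v GroupEnd)
           (Assign (v Total) (Bin Add (V Total)
             (Bin Div (Bin Sub (Read ''c'' (Bin Mul (Const 2) (position Idx))) (Const 1)) (Const 2))))))
         (\<lambda>s' t'. I3 hi s' (t' - 4) \<and> 4 \<le> t') s3 (t3 + 4)"
        proof (rule wp_Seq, rule use_conv)
          fix s4 t4 assume 4: "array_holds s4 ''c'' C" "t4 \<le> t3 + 4 + D" "frame conv s3 s4"
          have st4: "group_state S X lo hi a s4" "var s4 (v Total) = int T"
            using st_cong[OF 4(3) st3(1)] frame_var[OF 4(3), of "v Total"] st3
            by simp_all
          have "24 * (hi - lo) \<le> 24 * n" using hi by simp
          then have "t4 \<le> t + 20 + 40 * n + D" using 3(1) 4(2) unfolding I2_def by linarith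
          then show "wp W (For (v Idx) (V GroupStart) (v GroupEnd)
           (Assign (v Total) (Bin Add (V Total)
             (Bin Div (Bin Sub (Read ''c'' (Bin Mul (Const 2) (position Idx))) (Const 1)) (Const 2)))))
             (\<lambda>s' t'. I3 hi s' (t' - 4) \<and> 4 \<le> t') s4 t4"
            using 4 st4 by (intro accumulate) auto
        qed (use 3 st3 in auto)
      qed (use 2 st2 in auto)
    qed (use st in \<open>auto simp: group_state_def n_def\<close>)
  qed
  then show ?thesis
  proof (rule wp_mono, intro Q)
    fix s' t' assume *: "I3 hi s' (t' - 4) \<and> 4 \<le> t'"
    have "30 * (hi - lo) \<le> 30 * n" "1 \<le> n" using hi by auto
    then show "t' \<le> t + 110 * n + D" using * unfolding I3_def by linarith
    show "var s' (v Total) = int (T + card (letter_pairs S a))"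
      using * sum_h by (simp add: I3_def del: of_nat_sum)
  qed
qed

text \<open>The scan stops at the end or at the first different letter. Since it always passes at
  least one key, the constant overhead is absorbed by the length of the group.\<close>

lemma wp_find_group:
  fixes S :: "int list" and X :: "nat \<Rightarrow> int"
  defines "n \<equiv> length S"
  assumes len: "var s (v Len) = int n" and lo: "var s (v GroupStart) = int lo" "lo < n"
    and X: "arr s (v Keys) = X" "sorted_keys S X" and chars: "array_holds s (v Chars) S"
    and W: "int n + 8 \<le> W" and bd: "\<And>i. i \<le> n \<Longrightarrow> \<bar>X i\<bar> \<le> W"
    and Q: "\<And>s' t' hi. frame find_group s s' \<Longrightarrow> t' \<le> t + 40 * (hi - lo) \<Longrightarrow>
      lo < hi \<Longrightarrow> hi \<le> n \<Longrightarrow> group_state S X lo hi (X lo div int n) s' \<Longrightarrow>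
      (\<And>i. lo \<le> i \<Longrightarrow> i < hi \<Longrightarrow> X i div int n = X lo div int n) \<Longrightarrow>
      (hi < n \<Longrightarrow> X lo div int n < X hi div int n) \<Longrightarrow> Q s' t'"
  shows "wp W find_group Q s t"
proof -
  define a where "a = X lo div int n"
  define I where "I = (\<lambda>s' t'. \<exists>hi. lo < hi \<and> hi \<le> n \<and> t' \<le> t + 10 + 15 * (hi - lo) \<and>
    group_state S X lo hi a s' \<and> (\<forall>i. lo \<le> i \<and> i < hi \<longrightarrow> X i div int n = a))"
  have divW: "\<bar>X i div int n\<bar> \<le> W" if "i \<le> n" for i
    using abs_div_le[of "int n" "X i"] bd[OF that] lo by linarith
  have "wp W find_group (\<lambda>s' t'. \<exists>hi. t' \<le> t + 40 * (hi - lo) \<and> lo < hi \<and> hi \<le> n \<and>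
      group_state S X lo hi a s' \<and> (\<forall>i. lo \<le> i \<and> i < hi \<longrightarrow> X i div int n = a) \<and>
      (hi < n \<longrightarrow> X hi div int n \<noteq> a)) s t"
    unfolding find_group_def
  proof (intro wp_Seq wp_Assign wp_While[where I = I and \<mu> = "\<lambda>s. n - nat (var s (v GroupEnd))"], goal_cases)
    case 3
    have "\<forall>i. lo \<le> i \<and> i < Suc lo \<longrightarrow> X i div int n = a"
      by (metis a_def le_antisym less_Suc_eq_le)
    then show ?case
      unfolding I_def using len lo X(1) chars
      by (intro exI[of _ "Suc lo"]) (simp add: group_state_def n_def[symmetric] a_def[symmetric] array_holds_def)
  next
    case (4 s1 t1)
    then obtain hi where "hi \<le> n" "group_state S X lo hi a s1" by (auto simp: I_def)
    then show ?case using divW[of hi] divW[of lo] W bd[of hi] lo(2)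
      by (simp add: group_state_def n_def[symmetric] a_def[symmetric])
  next
    case (5 s1 t1)
    then obtain hi where "hi \<le> n" "group_state S X lo hi a s1" by (auto simp: I_def)
    then show ?case using 5(3) W by (auto simp: group_state_def n_def[symmetric])
  next
    case (6 s1 t1)
    then obtain hi where hi: "lo < hi" "hi \<le> n" "t1 \<le> t + 10 + 15 * (hi - lo)"
      "group_state S X lo hi a s1" "\<forall>i. lo \<le> i \<and> i < hi \<longrightarrow> X i div int n = a" by (auto simp: I_def)
    then have *: "hi < n" "X hi div int n = a" using 6(3) by (auto simp: group_state_def n_def[symmetric])
    have "\<forall>i. lo \<le> i \<and> i < Suc hi \<longrightarrow> X i div int n = a"
      using *(2) hi(5) by (metis less_Suc_eq)
    then show ?case
      unfolding I_def using * hi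
      by (intro conjI exI[of _ "Suc hi"]) (simp_all add: group_state_def n_def[symmetric] array_holds_def Suc_diff_le)
  next
    case (7 s1 t1)
    then obtain hi where hi: "lo < hi" "hi \<le> n" "t1 \<le> t + 10 + 15 * (hi - lo)"
      "group_state S X lo hi a s1" "\<forall>i. lo \<le> i \<and> i < hi \<longrightarrow> X i div int n = a" by (auto simp: I_def)
    then have "hi < n \<longrightarrow> X hi div int n \<noteq> a" using 7(3) by (auto simp: group_state_def n_def[symmetric])
    then show ?case using hi by (intro exI[of _ hi]) auto
  qed (use len lo X(1) W bd[of lo] divW[of lo] in simp_all)
  then show ?thesis
  proof (rule wp_mono)
    fix s' t' assume fr: "frame find_group s s'" and "\<exists>hi. t' \<le> t + 40 * (hi - lo) \<and> lo < hi \<and> hi \<le> n \<and>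
      group_state S X lo hi a s' \<and> (\<forall>i. lo \<le> i \<and> i < hi \<longrightarrow> X i div int n = a) \<and>
      (hi < n \<longrightarrow> X hi div int n \<noteq> a)"
    then obtain hi where hi: "t' \<le> t + 40 * (hi - lo)" "lo < hi" "hi \<le> n"
      "group_state S X lo hi a s'" "\<forall>i. lo \<le> i \<and> i < hi \<longrightarrow> X i div int n = a"
      "hi < n \<longrightarrow> X hi div int n \<noteq> a" by blast
    \<comment> \<open>The loop only ends with a different letter; sortedness makes it a larger one,
      so the letter of the group cannot occur again later.\<close>
    have less: "X lo div int n < X hi div int n" if "hi < n"
      using sorted_keys_div_mono[OF X(2), of lo hi] hi(2,6) that by (simp add: n_def a_def)
    have "X i div int n = X lo div int n" if "lo \<le> i" "i < hi" for i
      using hi(5) that unfolding a_def by blast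
    from Q[OF fr hi(1-3) hi(4)[unfolded a_def] this less] show "Q s' t'" .
  qed
qed

text \<open>The program compares the very quantities whose minimum appears in the bound, so the
  branch taken is always the one that the minimum charges for.\<close>

lemma wp_count_group:
  fixes S :: "int list" and X :: "nat \<Rightarrow> int" and T D kc r :: nat
  defines "n \<equiv> length S" and "g \<equiv> (\<lambda>i. nat (X i mod int (length S)))"
  assumes st: "group_state S X lo hi a s" and T: "var s (v Total) = int T" "T \<le> n * n"
    and r: "var s (v Rounds) = int r" "1 \<le> r" "r \<le> n"
    and X: "sorted_keys S X" and W: "3 * (int n * int n) + 4 * int n + 8 \<le> W"
    and hi: "lo < hi" "hi \<le> n" and bd: "\<And>i. i \<le> n \<Longrightarrow> \<bar>X i\<bar> \<le> W" "\<And>x. x \<in> set S \<Longrightarrow> \<bar>x\<bar> \<le> W"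
    and a: "\<bar>a\<bar> \<le> W"
    and bij: "bij_betw g {lo..<hi} (occurrences S a)"
    and conv: "convolves_within conv kc (real (D * (n * r))) (indicator_list S a) (indicator_list S a)"
      "word_bound kc n \<le> W"
    and Q: "\<And>s' t'. frame count_group s s' \<Longrightarrow>
      t' \<le> t + (130 + D) * min ((hi - lo) * (hi - lo)) (n * r) \<Longrightarrow>
      var s' (v Total) = int (T + card (letter_pairs S a)) \<Longrightarrow> Q s' t'"
  shows "wp W count_group Q s t"
proof -
  define f where "f = hi - lo"
  have f: "int hi - int lo = int f" "1 \<le> f" "f \<le> n" using hi by (auto simp: f_def)
  \<comment> \<open>Both sides of the comparison are at most \<open>n * n\<close>, the left one
    because \<open>r \<le> n\<close>; so evaluating it does not overflow.\<close>
  have "f * f \<le> n * n" "n * r \<le> n * n" using f r by (auto intro: mult_le_mono)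
  then have "int (f * f) \<le> int (n * n)" "int (n * r) \<le> int (n * n)" by (simp_all only: of_nat_le_iff)
  then have nn: "int f * int f \<le> int n * int n" "int n * int r \<le> int n * int n" "0 \<le> int n * int n"
    unfolding of_nat_mult by simp_all
  have W': "int f * int f \<le> W" "int n * int r \<le> W" "int n \<le> W" "int f \<le> W" "int r \<le> W"
    using W nn f(3) r(3) by linarith+
  have rd: "var s (v GroupStart) = int lo" "var s (v GroupEnd) = int hi" "var s (v Len) = int n"
    using st by (auto simp: group_state_def n_def)
  have "n \<le> n * r" "1 \<le> f * f" using r f by auto
  have cond: "bval (Less (Bin Mul (V Len) (V Rounds)) (Bin Mul group_size group_size)) s \<longleftrightarrow> n * r < f * f"
    using rd r f by (simp add: group_size_def flip: of_nat_mult)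
  have "wp W count_group (\<lambda>s' t'. t' \<le> t + (130 + D) * min (f * f) (n * r) \<and>
      var s' (v Total) = int (T + card (letter_pairs S a))) s t"
    unfolding count_group_def
  proof (intro wp_If)
    show "bsafe W (Less (Bin Mul (V Len) (V Rounds)) (Bin Mul group_size group_size)) s"
      using rd r f W' hi by (simp add: group_size_def)
  next
    assume "bval (Less (Bin Mul (V Len) (V Rounds)) (Bin Mul group_size group_size)) s"
    then have "min (f * f) (n * r) = n * r" using cond by simp
    \<comment> \<open>12 is the cost of the comparison. The linear work around the convolution is at
      most \<open>n * r\<close> up to a constant because \<open>r \<ge> 1\<close>.\<close>
    moreover have "12 + 110 * n + D * (n * r) \<le> (130 + D) * (n * r)"
      using \<open>n \<le> n * r\<close> f unfolding add_mult_distrib by linarith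
    ultimately show "wp W count_by_convolution (\<lambda>s' t'. t' \<le> t + (130 + D) * min (f * f) (n * r) \<and>
        var s' (v Total) = int (T + card (letter_pairs S a))) s
        (t + (1 + bcost (Less (Bin Mul (V Len) (V Rounds)) (Bin Mul group_size group_size))))"
      by (intro wp_count_by_convolution[OF st T(1) _ X _ hi(1) _ _ _ conv(1)])
        (use T W hi bd bij conv(2) in \<open>auto simp: n_def g_def group_size_def\<close>)
  next
    assume "\<not> bval (Less (Bin Mul (V Len) (V Rounds)) (Bin Mul group_size group_size)) s"
    then have "min (f * f) (n * r) = f * f" using cond by simp
    moreover have "12 + 100 * (f * f) \<le> (130 + D) * (f * f)"
      using \<open>1 \<le> f * f\<close> unfolding add_mult_distrib by linarith
    ultimately show "wp W count_pairs (\<lambda>s' t'. t' \<le> t + (130 + D) * min (f * f) (n * r) \<and>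
        var s' (v Total) = int (T + card (letter_pairs S a))) s
        (t + (1 + bcost (Less (Bin Mul (V Len) (V Rounds)) (Bin Mul group_size group_size))))"
      by (intro wp_count_pairs[OF st T(1) _ X _ hi(1) _ _ _ a])
        (use T W hi bd bij in \<open>auto simp: n_def g_def group_size_def f_def\<close>)
  qed
  then show ?thesis
    by (rule wp_mono) (rule Q, auto simp: f_def)
qed

lemma wp_count_all:
  fixes S :: "int list" and X :: "nat \<Rightarrow> int" and D kc r :: nat
  defines "n \<equiv> length S"
  assumes len: "var s (v Len) = int n" and X: "arr s (v Keys) = X" "sorted_keys S X"
    and chars: "array_holds s (v Chars) S"
    and r: "var s (v Rounds) = int r" "1 \<le> r" "r \<le> n"
    and W: "3 * (int n * int n) + 4 * int n + 8 \<le> W"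
    and bd: "\<And>i. i \<le> n \<Longrightarrow> \<bar>X i\<bar> \<le> W" "\<And>x. x \<in> set S \<Longrightarrow> \<bar>x\<bar> \<le> W"
    and conv: "\<And>a. convolves_within conv kc (real (D * (n * r))) (indicator_list S a) (indicator_list S a)"
      "word_bound kc n \<le> W"
    and Q: "\<And>s' t'. frame count_all s s' \<Longrightarrow>
      t' \<le> t + 20 + (\<Sum>a\<in>set S. (200 + D) * min (card (occurrences S a) * card (occurrences S a)) (n * r)) \<Longrightarrow>
      var s' (v Total) = int (card (three_sub_cadences S)) \<Longrightarrow> Q s' t'"
  shows "wp W count_all Q s t"
proof -
  define f where "f = (\<lambda>a. card (occurrences S a))"
  define cost where "cost = (\<lambda>a. (200 + D) * min (f a * f a) (n * r))"
  define letter where "letter = (\<lambda>i. X i div int n)"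
  define A where "A = (\<lambda>lo. letter ` {..<lo})"
  \<comment> \<open>The last conjunct says that \<open>lo\<close> is a boundary between groups: the
    next letter is larger than all letters in \<open>A lo\<close>. Hence it is new, and its pairs
    and its cost enter both sums exactly once.\<close>
  define I where "I = (\<lambda>(s' :: state) t'. \<exists>lo\<le>n. var s' (v GroupStart) = int lo \<and>
    var s' (v Total) = int (\<Sum>a\<in>A lo. card (letter_pairs S a)) \<and>
    t' \<le> t + 4 + (\<Sum>a\<in>A lo. cost a) \<and> (lo < n \<longrightarrow> (\<forall>i<lo. letter i < letter lo)))"
  have nW: "int n + 8 \<le> W" "int n \<le> W" "8 \<le> W" using W zero_le_mult_iff[of "int n" "int n"] by linarith+
  have An: "A n = set S"
    using sorted_keys_set[OF X(2)] by (simp add: A_def letter_def n_def)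
  have mono: "letter i \<le> letter j" if "i \<le> j" "j < n" for i j
    using sorted_keys_div_mono[OF X(2)] that by (simp add: letter_def n_def)
  have "wp W count_all (\<lambda>s' t'. t' \<le> t + 20 + (\<Sum>a\<in>set S. cost a) \<and>
      var s' (v Total) = int (card (three_sub_cadences S))) s t"
    unfolding count_all_def
  proof (intro wp_Seq wp_Assign wp_While[where I = I and \<mu> = "\<lambda>s. n - nat (var s (v GroupStart))"], goal_cases)
    case 3
    then show ?case by (auto simp: I_def A_def)
  next
    case (4 s1 t1)
    then have "var s1 (v Len) = int n" using len
      by (simp add: frame_def count_group_def count_pairs_def count_by_convolution_def find_group_def)
    then show ?case using 4(2) nW by (auto simp: I_def)
  next
    case (5 s1 t1)
    then have rd: "var s1 (v Len) = int n" "var s1 (v Rounds) = int r" "arr s1 (v Keys) = X"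
      "array_holds s1 (v Chars) S" using len r(1) X(1) chars
      by (simp_all add: frame_def count_group_def count_pairs_def count_by_convolution_def find_group_def array_holds_def)
    from 5(2) obtain lo where lo: "lo \<le> n" "var s1 (v GroupStart) = int lo"
      "var s1 (v Total) = int (\<Sum>a\<in>A lo. card (letter_pairs S a))"
      "t1 \<le> t + 4 + (\<Sum>a\<in>A lo. cost a)" "lo < n \<longrightarrow> (\<forall>i<lo. letter i < letter lo)"
      unfolding I_def by blast
    have lon: "lo < n" using 5(3) rd(1) lo(2) by simp
    have less: "letter i < letter lo" if "i < lo" for i using lo(5) lon that by blast
    show ?case
    proof (rule wp_find_group[where S = S and X = X and lo = lo])
      fix s2 t2 hi
      assume fg: "frame find_group s1 s2" "t2 \<le> t1 + (1 + bcost (Less (V GroupStart) (V Len))) + 40 * (hi - lo)"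
        "lo < hi" "hi \<le> length S" "group_state S X lo hi (X lo div int (length S)) s2"
        "\<And>i. lo \<le> i \<Longrightarrow> i < hi \<Longrightarrow> X i div int (length S) = X lo div int (length S)"
        "hi < length S \<Longrightarrow> X lo div int (length S) < X hi div int (length S)"
      define a where "a = letter lo"
      have hi: "hi \<le> n" "group_state S X lo hi a s2" "\<And>i. lo \<le> i \<Longrightarrow> i < hi \<Longrightarrow> letter i = a"
        "hi < n \<Longrightarrow> a < letter hi"
        using fg(4-7) unfolding a_def letter_def n_def by blast+
      have grp: "X i div int (length S) = a \<longleftrightarrow> lo \<le> i \<and> i < hi" if "i < length S" for i
      proof -
        have "letter i = a \<longleftrightarrow> lo \<le> i \<and> i < hi"
        proof (cases "hi \<le> i")
          case True
          then have "a < letter i" using mono[of hi i] hi(4) that by (auto simp: n_def)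
          then show ?thesis using True by simp
        next
          case False
          then show ?thesis using less[of i] hi(3)[of i] by (cases "i < lo") (auto simp: a_def)
        qed
        then show ?thesis by (simp add: letter_def n_def)
      qed
      have bij: "bij_betw (\<lambda>i. nat (X i mod int (length S))) {lo..<hi} (occurrences S a)"
        by (rule bij_betw_group[OF X(2) fg(4) grp])
      have fa: "f a = hi - lo" using bij_betw_same_card[OF bij] by (simp add: f_def)
      have Ahi: "A hi = insert a (A lo)"
      proof -
        have "{..<hi} = {..<lo} \<union> {lo..<hi}" using fg(3) by auto
        moreover have "letter ` {lo..<hi} = {a}" using hi(3) fg(3) by force
        ultimately show ?thesis by (auto simp: A_def image_Un)
      qed
      have aA: "a \<notin> A lo" "finite (A lo)" using less by (force simp: A_def a_def)+
      have aS: "a \<in> set S" and sub: "A lo \<subseteq> set S" using lon unfolding An[symmetric] A_def a_def by auto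
      have "(\<Sum>a\<in>A lo. card (letter_pairs S a)) \<le> (\<Sum>a\<in>set S. card (letter_pairs S a))"
        by (rule sum_mono2[OF _ sub]) auto
      also have "\<dots> \<le> n * n" unfolding n_def by (rule sum_card_letter_pairs_le)
      finally have T: "(\<Sum>a\<in>A lo. card (letter_pairs S a)) \<le> n * n" .
      have rd2: "var s2 (v Total) = int (\<Sum>a\<in>A lo. card (letter_pairs S a))" "var s2 (v Rounds) = int r"
        using frame_var[OF fg(1), of "v Total"] frame_var[OF fg(1), of "v Rounds"] lo(3) rd(2)
        by (simp_all add: find_group_def)
      show "wp W (Seq count_group (Assign (v GroupStart) (V GroupEnd)))
          (\<lambda>s' t'. I s' t' \<and> n - nat (var s' (v GroupStart)) < n - nat (var s1 (v GroupStart))) s2 t2"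
      proof (intro wp_Seq, rule wp_count_group[OF hi(2) rd2(1) _ rd2(2) r(2) _ X(2) _ fg(3,4) _ _ _ bij])
        fix s3 t3 assume cg: "frame count_group s2 s3"
          "t3 \<le> t2 + (130 + D) * min ((hi - lo) * (hi - lo)) (length S * r)"
          "var s3 (v Total) = int ((\<Sum>a\<in>A lo. card (letter_pairs S a)) + card (letter_pairs S a))"
        have ge: "var s3 (v GroupEnd) = int hi"
          using frame_var[OF cg(1), of "v GroupEnd"] hi(2)
          by (simp add: count_group_def count_pairs_def count_by_convolution_def group_state_def)
        \<comment> \<open>The size of a group is at most each of the two terms of the minimum, so
          the linear scan of \<open>find_group\<close> is absorbed; this is where 130 grows to
          200.\<close>
        have "hi - lo \<le> (hi - lo) * (hi - lo)" "hi - lo \<le> n * r"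
          using hi(1) r(2) by (auto intro: order_trans[of _ n])
        then have "hi - lo \<le> min (f a * f a) (n * r)" by (simp add: fa)
        moreover have "1 \<le> hi - lo" using fg(3) by simp
        moreover have "t3 \<le> t1 + 4 + 40 * (hi - lo) + (130 + D) * min (f a * f a) (n * r)"
          using cg(2) fg(2) by (simp add: fa n_def)
        ultimately have "t3 + 2 \<le> t1 + cost a"
          unfolding cost_def add_mult_distrib by linarith
        then have "t3 + 2 \<le> t + 4 + (\<Sum>a\<in>A hi. cost a)"
          using lo(4) aA by (simp add: Ahi)
        moreover have "var s3 (v Total) = int (\<Sum>a\<in>A hi. card (letter_pairs S a))"
          using cg(3) aA by (simp add: Ahi)
        moreover have "letter i < letter hi" if "hi < n" "i < hi" for i
          using hi(4)[OF that(1)] mono[of i lo] hi(3)[of i] that(2) lon by (cases "i \<le> lo") (auto simp: a_def)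
        ultimately show "wp W (Assign (v GroupStart) (V GroupEnd))
          (\<lambda>s' t'. I s' t' \<and> n - nat (var s' (v GroupStart)) < n - nat (var s1 (v GroupStart))) s3 t3"
          using ge hi(1) nW lo(2) fg(3) lon
          by (intro wp_Assign) (auto simp: I_def intro!: exI[of _ hi] simp del: of_nat_sum)
      qed (use T r W bd conv aS in \<open>auto simp: n_def\<close>)
    qed (use rd lo lon X(2) nW bd in \<open>auto simp: n_def\<close>)
  next
    case (6 s1 t1)
    then have "var s1 (v Len) = int n" using len
      by (simp add: frame_def count_group_def count_pairs_def count_by_convolution_def find_group_def)
    with 6 have "var s1 (v Total) = int (\<Sum>a\<in>A n. card (letter_pairs S a))" "t1 \<le> t + 4 + (\<Sum>a\<in>A n. cost a)"
      by (auto simp: I_def not_less)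
    then show ?case by (simp add: An card_three_sub_cadences)
  qed (use nW in auto)
  then show ?thesis
    by (rule wp_mono) (rule Q, auto simp: cost_def f_def)
qed

end

section \<open>The complete program\<close>

context fresh_names
begin

definition count_program :: com where
  "count_program =
     Seq (Assign (v Len) (Var ''n''))
         (If (Less (V Len) (Const 2))
           (Assign ''count'' (Const 0))
           (Seq load_input (Seq sort_keys (Seq count_all (Assign ''count'' (V Total))))))"

lemma wp_count_program:
  fixes S :: "int list" and D kc r :: nat
  defines "n \<equiv> length S"
  assumes len: "var s ''n'' = int n" and S: "array_holds s ''S'' S" and n: "2 \<le> n"
    and r: "n \<le> 2 ^ r" "2 ^ (r - 1) < n"
    and W: "3 * (int n * int n) + 4 * int n + 8 \<le> W"
    and bd: "\<And>x. x \<in> set S \<Longrightarrow> \<bar>x\<bar> * int n + int n \<le> W"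
    and conv: "\<And>a. convolves_within conv kc (real (D * (n * r))) (indicator_list S a) (indicator_list S a)"
      "word_bound kc n \<le> W"
    and Q: "\<And>s' t'. t' \<le> t + 100 + 30 * n + 150 * (n * r) +
        (\<Sum>a\<in>set S. (200 + D) * min (card (occurrences S a) * card (occurrences S a)) (n * r)) \<Longrightarrow>
      var s' ''count'' = int (card (three_sub_cadences S)) \<Longrightarrow> Q s' t'"
  shows "wp W count_program Q s t"
proof -
  have nW: "int n \<le> W" "8 \<le> W" "4 * int n + 8 \<le> W" using W zero_le_mult_iff[of "int n" "int n"] by linarith+
  have "r - 1 < 2 ^ (r - 1)" by (rule less_exp)
  with r(2) have rn: "r \<le> n" by linarith
  have r1: "1 \<le> r" using r(1) n by (cases r) auto
  have xW: "\<bar>x\<bar> \<le> W" if "x \<in> set S" for x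
  proof -
    have "\<bar>x\<bar> * 1 \<le> \<bar>x\<bar> * int n" using n by (intro mult_left_mono) auto
    then show ?thesis using bd[OF that] by linarith
  qed
  have keyW: "\<bar>S ! x * int n + int x\<bar> \<le> W" if "x < n" for x
  proof -
    have "\<bar>S ! x * int n\<bar> = \<bar>S ! x\<bar> * int n" by (simp add: abs_mult)
    then show ?thesis using bd[of "S ! x"] that by (simp add: n_def)
  qed
  let ?s1 = "s\<lparr>var := (var s)(v Len := aval (Var ''n'') s)\<rparr>"
  have s1: "var ?s1 (v Len) = int (length S)" "array_holds ?s1 ''S'' S"
    using len S by (simp_all add: n_def array_holds_def)
  have main: "wp W (Seq load_input (Seq sort_keys (Seq count_all (Assign ''count'' (V Total))))) Q ?s1 (t + 6)"
  proof (rule wp_Seq, rule wp_load_input[OF s1(1) _ s1(2)])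
    fix s2 t2 assume 2: "frame load_input ?s1 s2" "t2 \<le> t + 6 + 30 * length S + 15"
      "array_holds s2 (v Chars) S"
      "\<And>i. i < length S \<Longrightarrow> arr s2 (v Keys) i = S ! i * int (length S) + int i"
      "arr s2 (v Keys) (length S) = 0"
    have len2: "var s2 (v Len) = int n"
      using frame_var[OF 2(1), of "v Len"] s1(1) by (simp add: load_input_def n_def)
    have b2: "\<bar>arr s2 (v Keys) i\<bar> \<le> W" if "i \<le> n" for i
      using that keyW[of i] 2(4)[of i] 2(5) nW by (cases "i = n") (auto simp: n_def)
    have "inj_on (\<lambda>x. S ! x * int n + int x) {..<n}"
    proof (rule inj_onI)
      fix x y assume "x \<in> {..<n}" "y \<in> {..<n}" "S ! x * int n + int x = S ! y * int n + int y"
      then have "(S ! x * int n + int x) mod int n = (S ! y * int n + int y) mod int n" "x < n" "y < n"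
        by auto
      then show "x = y" by simp
    qed
    moreover have img: "arr s2 (v Keys) x = S ! x * int n + int x" if "x \<in> {..<n}" for x
      using that 2(4) by (simp add: n_def)
    ultimately have inj: "inj_on (arr s2 (v Keys)) {..<n}"
      using inj_on_cong[of "{..<n}" "arr s2 (v Keys)" "\<lambda>x. S ! x * int n + int x"] by blast
    show "wp W (Seq sort_keys (Seq count_all (Assign ''count'' (V Total)))) Q s2 t2"
    proof (rule wp_Seq, rule wp_sort_keys[OF len2 n nW(3) refl b2 inj r], assumption)
      fix s3 t3 assume 3: "frame sort_keys s2 s3" "t3 \<le> t2 + 150 * (n * r) + 20"
        "var s3 (v Rounds) = int r" "strict_mono_on {..<n} (arr s3 (v Keys))"
        "arr s3 (v Keys) ` {..<n} = arr s2 (v Keys) ` {..<n}"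
        "arr s3 (v Keys) n = arr s2 (v Keys) n"
      have len3: "var s3 (v Len) = int (length S)"
        using frame_var[OF 3(1), of "v Len"] len2
        by (simp add: sort_keys_def merge_pass_def start_block_def set_min_def merge_step_def copy_back_def n_def)
      have chars: "array_holds s3 (v Chars) S"
        using frame_arr[OF 3(1), of "v Chars"] 2(3)
        by (simp add: sort_keys_def merge_pass_def start_block_def set_min_def merge_step_def copy_back_def array_holds_def)
      have sk: "sorted_keys S (arr s3 (v Keys))"
        using 3(4,5) img unfolding sorted_keys_def n_def[symmetric] by simp
      have b3: "\<bar>arr s3 (v Keys) i\<bar> \<le> W" if "i \<le> n" for i
      proof (cases "i = n")
        case False
        then have "arr s3 (v Keys) i \<in> arr s2 (v Keys) ` {..<n}"
          unfolding 3(5)[symmetric] using that by simp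
        then show ?thesis using b2 by auto
      qed (use 3(6) b2 in auto)
      show "wp W (Seq count_all (Assign ''count'' (V Total))) Q s3 t3"
      proof (rule wp_Seq, rule wp_count_all[OF len3 refl sk chars 3(3) r1])
        fix s4 :: state and t4 :: nat
        assume 4: "var s4 (v Total) = int (card (three_sub_cadences S))"
          "t4 \<le> t3 + 20 + (\<Sum>a\<in>set S. (200 + D) *
             min (card (occurrences S a) * card (occurrences S a)) (length S * r))"
        have "card (three_sub_cadences S) \<le> n * n"
          unfolding card_three_sub_cadences n_def by (rule sum_card_letter_pairs_le)
        then have "int (card (three_sub_cadences S)) \<le> int (n * n)" by (simp only: of_nat_le_iff)
        then have "int (card (three_sub_cadences S)) \<le> W"
          using W zero_le_mult_iff[of "int n" "int n"] by simp
        then show "wp W (Assign ''count'' (V Total)) Q s4 t4"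
          using 4 3(2) 2(2) by (intro wp_Assign Q) (auto simp: n_def)
      qed (use rn W b3 xW conv in \<open>auto simp: n_def\<close>)
    qed
  qed (use nW bd in \<open>auto simp: n_def\<close>)
  have time: "t + (1 + acost (Var ''n'')) + (1 + bcost (Less (V Len) (Const 2))) = t + 6" by simp
  show ?thesis
    unfolding count_program_def
  proof (rule wp_Seq, rule wp_Assign, goal_cases)
    case 2
    show ?case
      by (rule wp_If, unfold time) (use main len n nW in auto)
  qed (use len nW in simp)
qed

text \<open>The cut-off 2 is that of the time bound: for shorter strings the logarithmic expression
  is 0, while every run takes some operations.\<close>

lemma wp_count_program_short:
  assumes len: "var s ''n'' = int (length S)" and S: "length S < 2" and W: "8 \<le> W"
    and Q: "\<And>s' t'. t' \<le> t + 8 \<Longrightarrow> var s' ''count'' = int (card (three_sub_cadences S)) \<Longrightarrow> Q s' t'"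
  shows "wp W count_program Q s t"
proof -
  have "three_sub_cadences S = {}"
    using S by (auto simp: three_sub_cadences_def three_sub_cadence_def)
  then show ?thesis
    unfolding count_program_def
    by (intro wp_Seq wp_Assign wp_If Q) (use len S W in auto)
qed

end

text \<open>The names chosen have pairwise different lengths, all larger than the length of any
  forbidden name; only finitely many names are forbidden because a program writes to finitely
  many.\<close>

lemma ex_fresh_names: "\<exists>v. fresh_names v conv"
proof -
  define U where "U = {''n'', ''S'', ''m'', ''a'', ''b'', ''c'', ''count''} \<union>
    written_vars conv \<union> written_arrs conv"
  define N where "N = Suc (Max (length ` U))"
  define v where "v = (\<lambda>r :: register. replicate (N + to_nat r) (CHR ''v''))"
  have fin: "finite U" by (simp add: U_def finite_written)
  have "v r \<notin> U" for r
  proof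
    assume "v r \<in> U"
    then have "length (v r) \<le> Max (length ` U)" using fin by (intro Max_ge) auto
    then show False by (simp add: v_def N_def)
  qed
  moreover have "inj v"
  proof (rule injI)
    fix r r' assume "v r = v r'"
    then have "length (v r) = length (v r')" by simp
    then show "r = r'" by (simp add: v_def)
  qed
  ultimately have "fresh_names v conv"
    unfolding fresh_names_def U_def by blast
  then show ?thesis by blast
qed

section \<open>The running time\<close>

text \<open>Minimality gives \<open>r - 1 < log 2 n\<close>, and \<open>1 \<le> log 2 n\<close>
  because \<open>n \<ge> 2\<close>; together they yield the factor 2. The lower bound on
  \<open>r\<close> is needed to express the time of the convolution through
  \<open>n * r\<close>.\<close>

lemma ex_rounds:
  fixes n :: nat
  assumes "2 \<le> n"
  obtains r where "n \<le> 2 ^ r" "2 ^ (r - 1) < n" "log 2 (real n) \<le> real r" "real r \<le> 2 * log 2 (real n)"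
proof -
  define r where "r = (LEAST r. n \<le> 2 ^ r)"
  have "n \<le> 2 ^ n" using less_exp[of n] by simp
  then have 1: "n \<le> 2 ^ r" unfolding r_def by (rule LeastI)
  then have "r \<noteq> 0" using assms by (intro notI) simp
  then have 2: "2 ^ (r - 1) < n"
    using not_less_Least[of "r - 1" "\<lambda>r. n \<le> 2 ^ r"] by (simp add: r_def not_le)
  have "real n \<le> 2 ^ r" using 1 by (metis of_nat_le_iff of_nat_numeral of_nat_power)
  then have "log 2 (real n) \<le> log 2 (2 ^ r)" using assms by (intro log_mono) auto
  then have 3: "log 2 (real n) \<le> real r" by (simp add: log_nat_power)
  have "2 ^ (r - 1) < real n" using 2 by (metis of_nat_less_iff of_nat_numeral of_nat_power)
  then have "log 2 (2 ^ (r - 1)) < log 2 (real n)" by (intro log_less) auto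
  then have "real (r - 1) < log 2 (real n)" by (simp add: log_nat_power)
  moreover have "log 2 2 \<le> log 2 (real n)" using assms by (intro log_mono) auto
  ultimately have "real r \<le> 2 * log 2 (real n)" using \<open>r \<noteq> 0\<close> by simp
  with 1 2 3 show ?thesis by (rule that)
qed

text \<open>For \<open>b = n log n\<close> these are the two terms of the minimum.\<close>

lemma sum_min_square_le:
  fixes f :: "'a \<Rightarrow> nat" and b :: real
  assumes "0 \<le> b"
  shows "(\<Sum>a\<in>A. min (real (f a * f a)) b) \<le> real (card A) * b"
    and "(\<Sum>a\<in>A. min (real (f a * f a)) b) \<le> real (\<Sum>a\<in>A. f a) * sqrt b"
proof -
  show "(\<Sum>a\<in>A. min (real (f a * f a)) b) \<le> real (card A) * b"
    by (rule sum_bounded_above) simp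
  \<comment> \<open>The minimum of two nonnegative numbers is at most their geometric mean, here of
    the square of \<open>f a\<close> and \<open>b\<close>.\<close>
  have "min (real (f a * f a)) b \<le> real (f a) * sqrt b" for a
  proof (cases "real (f a) \<le> sqrt b")
    case True
    then have "real (f a) * real (f a) \<le> real (f a) * sqrt b" by (intro mult_left_mono) auto
    then show ?thesis by simp
  next
    case False
    then have "sqrt b * sqrt b \<le> real (f a) * sqrt b" using assms by (intro mult_right_mono) auto
    then show ?thesis using assms by simp
  qed
  then have "(\<Sum>a\<in>A. min (real (f a * f a)) b) \<le> (\<Sum>a\<in>A. real (f a) * sqrt b)"
    by (rule sum_mono)
  then show "(\<Sum>a\<in>A. min (real (f a * f a)) b) \<le> real (\<Sum>a\<in>A. f a) * sqrt b"
    by (simp add: sum_distrib_right)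
qed

text \<open>Loading and sorting take \<open>O(n log n)\<close> and the letters take
  \<open>M\<close>. It suffices that each term of the minimum dominates \<open>n * L\<close> and, up
  to a factor 2, also \<open>M\<close>.\<close>

lemma running_time_le:
  fixes S :: "int list" and D r :: nat
  defines "n \<equiv> length S" and "L \<equiv> log 2 (real (length S))"
  assumes n: "2 \<le> n" and r: "real r \<le> 2 * L" and A: "finite A" "set S \<subseteq> A"
    and t: "t \<le> 100 + 30 * n + 150 * (n * r) +
        (\<Sum>a\<in>set S. (200 + D) * min (card (occurrences S a) * card (occurrences S a)) (n * r))"
  shows "real t \<le> (1000 + 4 * real D) * min (real (card A) * real n * L) (real n powr (3 / 2) * L powr (1 / 2))"
proof -
  define f where "f = (\<lambda>a. card (occurrences S a))"
  define M where "M = (\<Sum>a\<in>set S. min (real (f a * f a)) (2 * (n * L)))"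
  have "log 2 2 \<le> log 2 (real n)" using n by (intro log_mono) auto
  then have L1: "1 \<le> L" by (simp add: L_def n_def)
  \<comment> \<open>From \<open>L \<le> n\<close> it follows that sorting, which costs
    \<open>n * L\<close>, also stays below \<open>n powr (3 / 2) * L powr (1 / 2)\<close>.\<close>
  have Ln: "L \<le> real n"
  proof -
    have "real n \<le> 2 ^ n" using less_exp[of n] by (metis less_imp_le of_nat_le_iff of_nat_numeral of_nat_power)
    then have "log 2 (real n) \<le> log 2 (2 ^ n)" using n by (intro log_mono) auto
    then show ?thesis by (simp add: log_nat_power L_def n_def)
  qed
  have nr: "real (n * r) \<le> 2 * (n * L)"
    using mult_left_mono[OF r, of "real n"] by simp
  have "real t \<le> real (100 + 30 * n + 150 * (n * r) + (\<Sum>a\<in>set S. (200 + D) * min (f a * f a) (n * r)))"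
    using t unfolding f_def of_nat_le_iff .
  also have "\<dots> = 100 + 30 * real n + 150 * real (n * r) +
      (200 + real D) * (\<Sum>a\<in>set S. min (real (f a * f a)) (real (n * r)))"
    by (simp add: sum_distrib_left of_nat_min)
  also have "\<dots> \<le> 100 + 30 * real n + 150 * (2 * (n * L)) + (200 + real D) * M"
    unfolding M_def using nr by (intro add_mono mult_left_mono sum_mono min.mono) auto
  also have "100 + 30 * real n \<le> 80 * (real n * L)"
  proof -
    have "real n * 1 \<le> real n * L" using L1 by (intro mult_left_mono) auto
    moreover have "100 \<le> 50 * real n" using n by simp
    ultimately show ?thesis by linarith
  qed
  finally have t_le: "real t \<le> 380 * (n * L) + (200 + real D) * M" by (simp add: mult.commute)
  \<comment> \<open>\<open>B\<close> stands for either term of the minimum. The factor 2 in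
    \<open>M \<le> 2 * B\<close> stems from \<open>r \<le> 2 * L\<close>; in the second case
    \<open>sqrt 2\<close> would do and is rounded up. The sum \<open>780 + 2 * D\<close> of the
    coefficients is rounded up generously.\<close>
  have bound: "real t \<le> (1000 + 4 * real D) * B" if "n * L \<le> B" "M \<le> 2 * B" for B
  proof -
    have "380 * (n * L) + (200 + real D) * M \<le> 380 * B + (200 + real D) * (2 * B)"
      using that by (intro add_mono mult_left_mono) auto
    also have "\<dots> = (780 + 2 * real D) * B" by (simp add: algebra_simps)
    also have "\<dots> \<le> (1000 + 4 * real D) * B"
    proof (rule mult_right_mono)
      have "0 \<le> real n * L" using L1 by simp
      then show "0 \<le> B" using that(1) by linarith
    qed simp
    finally show ?thesis using t_le by linarith
  qed
  have "set S \<noteq> {}" using n by (auto simp: n_def)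
  then have c1: "1 \<le> card A" "card (set S) \<le> card A"
    using A by (auto simp: Suc_le_eq card_gt_0_iff intro: card_mono)
  have nL: "0 \<le> real n * L" using L1 by simp
  have "real t \<le> (1000 + 4 * real D) * (real (card A) * real n * L)"
  proof (rule bound)
    have "1 * (real n * L) \<le> real (card A) * (real n * L)" using c1 nL by (intro mult_right_mono) auto
    then show "n * L \<le> real (card A) * real n * L" by (simp add: mult.assoc)
    have "M \<le> real (card (set S)) * (2 * (n * L))"
      unfolding M_def using nL by (intro sum_min_square_le) auto
    also have "\<dots> \<le> real (card A) * (2 * (n * L))" using c1 nL by (intro mult_right_mono) auto
    finally show "M \<le> 2 * (real (card A) * real n * L)" by (simp add: mult_ac)
  qed
  moreover have "real t \<le> (1000 + 4 * real D) * (real n powr (3 / 2) * L powr (1 / 2))"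
  proof (rule bound)
    have "real n powr (3 / 2) = real n powr 1 * real n powr (1 / 2)"
      unfolding powr_add[symmetric] by simp
    then have eq: "real n powr (3 / 2) * L powr (1 / 2) = real n * (sqrt n * sqrt L)"
      using n L1 by (simp add: powr_half_sqrt)
    have "sqrt L * sqrt L \<le> sqrt n * sqrt L" using Ln L1 by (intro mult_right_mono) auto
    then have "L \<le> sqrt n * sqrt L" using L1 by simp
    then show "n * L \<le> real n powr (3 / 2) * L powr (1 / 2)"
      unfolding eq by (intro mult_left_mono) auto
    have "M \<le> real (\<Sum>a\<in>set S. f a) * sqrt (2 * (n * L))"
      unfolding M_def using nL by (intro sum_min_square_le) auto
    also have "(\<Sum>a\<in>set S. f a) = n" unfolding f_def n_def by (rule sum_card_occurrences)
    also have "sqrt (2 * (n * L)) \<le> 2 * (sqrt n * sqrt L)"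
      using sqrt2_less_2 L1 by (simp add: real_sqrt_mult mult_right_mono)
    finally show "M \<le> 2 * (real n powr (3 / 2) * L powr (1 / 2))"
      unfolding eq by (simp add: mult_left_mono)
  qed
  ultimately show ?thesis by (simp add: min_def)
qed

lemma convolves_within_mono:
  "convolves_within p k T a b \<Longrightarrow> T \<le> T' \<Longrightarrow> convolves_within p k T' a b"
  unfolding convolves_within_def by (meson order_trans)

text \<open>The program and \<open>C\<close> precede \<open>c\<close>, so the constant is absolute;
  only the word size follows \<open>c\<close>, because the keys multiply letters by the length. The
  program is not given \<open>\<Sigma>\<close>. Strings shorter than 2 get a constant bound since
  the logarithmic one is 0 there.\<close>

theorem theorem4:
  assumes "fast_convolution"
  shows "\<exists>(p :: com) (C :: real). \<forall>c. \<exists>k. \<forall>(S :: int list) (\<Sigma> :: int set).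
    finite \<Sigma> \<and> set S \<subseteq> \<Sigma> \<and> (\<forall>x \<in> \<Sigma>. \<bar>x\<bar> \<le> word_bound c (length S)) \<longrightarrow>
    (let n = length S in
      counts_three_sub_cadences_within p k
        (if n < 2 then C
         else C * min (real (card \<Sigma>) * real n * log 2 (real n))
                      (real n powr (3 / 2) * log 2 (real n) powr (1 / 2))) S)"
proof -
  \<comment> \<open>Exponent 0 admits entries of absolute value at most 1, which is enough for
    indicator sequences. Thus \<open>conv\<close> is fixed before \<open>c\<close>.\<close>
  from assms obtain conv C0 kc where conv: "\<And>m a b. 2 \<le> m \<Longrightarrow>
      length a = m \<and> length b = m \<and> (\<forall>x \<in> set a \<union> set b. \<bar>x\<bar> \<le> word_bound 0 m) \<Longrightarrow>
      convolves_within conv kc (C0 * (real m * log 2 (real m))) a b"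
    unfolding fast_convolution_def by meson
  obtain v where "fresh_names v conv" using ex_fresh_names by blast
  then interpret fresh_names v conv .
  \<comment> \<open>A natural number above \<open>C0\<close> lets all times before the final
    estimate be computed in \<open>nat\<close>; \<open>C0\<close> itself could be negative or
    fractional.\<close>
  define D where "D = nat \<lceil>C0\<rceil>"
  have D: "C0 \<le> real D" unfolding D_def by linarith
  show ?thesis
  proof (intro exI[of _ count_program] exI[of _ "1000 + 4 * real D"] allI impI)
    fix c
    \<comment> \<open>\<open>kc\<close> is what \<open>conv\<close> needs. The exponent 3 covers
      addresses, products and counters, all within \<open>3 * n * n + 4 * n + 8\<close>. The keys
      need \<open>c + 3\<close>: they are at most \<open>(n + 2) ^ c * (2 * n)\<close> in absolute
      value.\<close>
    define k where "k = max kc (c + 3)"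
    show "\<exists>k. \<forall>S \<Sigma>. finite \<Sigma> \<and> set S \<subseteq> \<Sigma> \<and> (\<forall>x \<in> \<Sigma>. \<bar>x\<bar> \<le> word_bound c (length S)) \<longrightarrow>
      (let n = length S in
      counts_three_sub_cadences_within count_program k
        (if n < 2 then 1000 + 4 * real D
         else (1000 + 4 * real D) * min (real (card \<Sigma>) * real n * log 2 (real n))
                      (real n powr (3 / 2) * log 2 (real n) powr (1 / 2))) S)"
    proof (intro exI[of _ k] allI impI, elim conjE)
      fix S :: "int list" and \<Sigma> :: "int set"
      assume \<Sigma>: "finite \<Sigma>" "set S \<subseteq> \<Sigma>" "\<forall>x \<in> \<Sigma>. \<bar>x\<bar> \<le> word_bound c (length S)"
      define n where "n = length S"
      define W where "W = word_bound k n"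
      let ?b = "int n + 2"
      have pow: "?b ^ i \<le> W" if "i \<le> k" for i
        unfolding W_def word_bound_def using that by (intro power_increasing) auto
      have cube: "?b ^ 3 = int n * int n * int n + 6 * (int n * int n) + 12 * int n + 8"
        by (simp add: power3_eq_cube algebra_simps)
      have "0 \<le> int n * int n" "0 \<le> int n * int n * int n" by simp_all
      moreover have "?b ^ 3 \<le> W" by (rule pow) (simp add: k_def)
      ultimately have W: "3 * (int n * int n) + 4 * int n + 8 \<le> W"
        unfolding cube by linarith
      have bd: "\<bar>x\<bar> * int n + int n \<le> W" if "x \<in> set S" for x
      proof -
        have "\<bar>x\<bar> \<le> ?b ^ c" using \<Sigma> that by (auto simp: word_bound_def n_def)
        then have "\<bar>x\<bar> * int n + 1 * int n \<le> ?b ^ c * int n + ?b ^ c * int n"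
          by (intro add_mono mult_right_mono) (auto intro: one_le_power)
        also have "\<dots> = ?b ^ c * (2 * int n)" by simp
        also have "\<dots> \<le> ?b ^ c * ?b ^ 3"
          unfolding cube by (intro mult_left_mono) auto
        also have "\<dots> = ?b ^ (c + 3)" by (simp add: power_add)
        also have "\<dots> \<le> W" by (rule pow) (simp add: k_def)
        finally show ?thesis by simp
      qed
      have kcW: "word_bound kc n \<le> W"
        using pow[of kc] by (simp add: word_bound_def k_def)
      have "counts_three_sub_cadences_within count_program k
        (if n < 2 then 1000 + 4 * real D
         else (1000 + 4 * real D) * min (real (card \<Sigma>) * real n * log 2 (real n))
                      (real n powr (3 / 2) * log 2 (real n) powr (1 / 2))) S"
        (is "counts_three_sub_cadences_within _ _ ?T S")
        unfolding counts_three_sub_cadences_within_def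
      proof (intro allI impI, elim conjE)
        fix s assume s: "var s ''n'' = int (length S)" "array_holds s ''S'' S"
        have "wp W count_program (\<lambda>s' t'. real t' \<le> ?T \<and> var s' ''count'' = int (card (three_sub_cadences S))) s 0"
        proof (cases "n < 2")
          case True
          have "0 \<le> int n * int n" by simp
          then have "8 \<le> W" using W by linarith
          then show ?thesis using True
            by (intro wp_count_program_short[OF s(1)]) (auto simp: n_def)
        next
          case False
          then have n2: "2 \<le> n" by simp
          obtain r where r: "n \<le> 2 ^ r" "2 ^ (r - 1) < n" "log 2 (real n) \<le> real r"
            "real r \<le> 2 * log 2 (real n)"
            using ex_rounds[OF n2] .
          have cv: "convolves_within conv kc (real (D * (n * r))) (indicator_list S a) (indicator_list S a)" for a
          proof (rule convolves_within_mono[OF conv[OF n2]])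
            show "length (indicator_list S a) = n \<and> length (indicator_list S a) = n \<and>
                (\<forall>x\<in>set (indicator_list S a) \<union> set (indicator_list S a). \<bar>x\<bar> \<le> word_bound 0 n)"
              by (auto simp: n_def indicator_list_def word_bound_def)
            have "0 \<le> log 2 (real n)" using n2 by simp
            then have "C0 * (real n * log 2 (real n)) \<le> real D * (real n * real r)"
              using D r(3) by (intro mult_mono) auto
            then show "C0 * (real n * log 2 (real n)) \<le> real (D * (n * r))" by simp
          qed
          show ?thesis
          proof (rule wp_count_program[OF s _ r(1,2)[unfolded n_def] W[unfolded n_def] _ cv[unfolded n_def] kcW[unfolded n_def]])
            fix s' t'
            assume "var s' ''count'' = int (card (three_sub_cadences S))"
              "t' \<le> 0 + 100 + 30 * length S + 150 * (length S * r) + (\<Sum>a\<in>set S. (200 + D) *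
                 min (card (occurrences S a) * card (occurrences S a)) (length S * r))"
            then show "real t' \<le> ?T \<and> var s' ''count'' = int (card (three_sub_cadences S))"
              using running_time_le[of S r \<Sigma> t' D] n2 r(4) \<Sigma>(1,2) False by (simp add: n_def)
          qed (use n2 bd in \<open>auto simp: n_def\<close>)
        qed
        then show "\<exists>t s'. exec (word_bound k (length S)) count_program s t s' \<and> real t \<le> ?T \<and>
            var s' ''count'' = int (card (three_sub_cadences S))"
          unfolding wp_def W_def n_def by auto
      qed
      then show "let n = length S in counts_three_sub_cadences_within count_program k
        (if n < 2 then 1000 + 4 * real D
         else (1000 + 4 * real D) * min (real (card \<Sigma>) * real n * log 2 (real n))
                      (real n powr (3 / 2) * log 2 (real n) powr (1 / 2))) S"
        unfolding Let_def n_def .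
    qed
  qed
qed

end
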